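(* Fix a point $P\in\mathbb P$ and a coordinate $u$ with its pole at $P$. Let $z_1,z_2\in\mathbb P\setminus P$, $z_2\ne z_1$, let $\mathtt v\in\mathbf W^{z_1}$, and set $\hat S(z)=\hat e^3(z)+3\hat e^2(z)\hat i(z)+3\hat e(z)\hat i^2(z)+\hat i^3(z)$. Then, as $z_2\to z_1$, $$\Bigl[2\,\hat T(z_2)\hat b(z_1)-\frac{2}{(u(z_2)-u(z_1))^2}\,\hat b(z_1)-\frac{2}{u(z_2)-u(z_1)}\,\hat b'(z_1)\Bigr]\mathtt v\ \longrightarrow\ \bigl[\hat S(z_1)+\hat b''(z_1)\bigr]\mathtt v ,$$ where $\hat b'$ and $\hat b''$ are the first and second derivatives of the field $\hat b$ with respect to the vector field $d/du$.
   Context: $\mathbb P$ is a complex projective line; $K$ its canonical bundle, $K_z$ the fibre at $z$. A coordinate is a meromorphic function $u$ on $\mathbb P$ with exactly one pole, which is simple; $du_z\in K_z$ is the value of $du$ at $z$. $\mathbf K$ is the space of meromorphic 1-forms on $\mathbb P$ with all residues zero, $\mathbf K^z\subset\mathbf K$ the subspace of forms regular at $z$; $\mathbf W=S^*\mathbf K$, $\mathbf W^z=S^*\mathbf K^z$ are the symmetric algebras. Fields: $e(z):\mathbf W\to\mathbf W\otimes K_z$ is multiplication by $e_z=-\frac{du}{(u-u(z))^2}\otimes du_z$. $i(z):\mathbf W^z\to\mathbf W^z\otimes K_z$ is the derivation with $i(z)\mathbf 1=0$ and $i(z)\alpha=-\alpha(z)$ for $\alpha\in\mathbf K^z$. $b(z)=i(z)+e(z):\mathbf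 W^z\to\mathbf W\otimes K_z$. $T(z)=\tfrac12\{i(z)\circ i(z)+e(z)\circ e(z)+2e(z)\circ i(z)\}:\mathbf W^z\to\mathbf W\otimes K_z^2$. With the coordinate $u$ chosen, one writes $e(z)=\hat e(z)du_z$, $i(z)=\hat i(z)du_z$, $b(z)=\hat b(z)du_z$, $T(z)=\hat T(z)du_z^2$; the derivatives of $\hat b$ are taken with respect to the variable $u(z)$. Limits: for $\mathtt v\in\mathbf W^{z_1}$ the expressions are defined for $z_2\ne z_1$ in a Zariski neighbourhood of $z_1$ (depending on $\mathtt v$). The degree $m$ component of the expression is a symmetric polydifferential in $m$ auxiliary points depending rationally on those points and on $u(z_2)$; the limit statement means that each component has no pole along $z_2=z_1$ and that its restriction to $z_2=z_1$ is the corresponding component of the right side. *)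

theory Defs
  imports "HOL-Complex_Analysis.Complex_Analysis" "HOL-Library.Poly_Mapping" "HOL-Library.Multiset"
begin

section \<open>The projective line, coordinates\<close>

datatype cp1 = Fin complex | Infty

text \<open>A local parameter centred at the given point.\<close>

definition chart :: "cp1 \<Rightarrow> complex \<Rightarrow> cp1" where
  "chart p t = (case p of Fin a \<Rightarrow> Fin (a + t) | Infty \<Rightarrow> (if t = 0 then Infty else Fin (1 / t)))"

text \<open>As usual in the library, the value of a meromorphic function at a pole carries no meaning;
  at all other points a coordinate is required to take its true value.\<close>

definition is_coordinate :: "(cp1 \<Rightarrow> complex) \<Rightarrow> cp1 \<Rightarrow> bool" where
  "is_coordinate u P \<longleftrightarrow>
     (\<forall>q. (u \<circ> chart q) meromorphic_on {0}) \<and>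
     (\<forall>q. q \<noteq> P \<longrightarrow> (u \<circ> chart q) analytic_on {0}) \<and>
     is_pole (u \<circ> chart P) 0 \<and> zorder (u \<circ> chart P) 0 = -1"

text \<open>The derivative of a function on the projective line along the vector field \<open>d/du\<close>.\<close>

definition ddu :: "(cp1 \<Rightarrow> complex) \<Rightarrow> (cp1 \<Rightarrow> complex) \<Rightarrow> cp1 \<Rightarrow> complex" where
  "ddu u F z = deriv (F \<circ> chart z) 0 / deriv (u \<circ> chart z) 0"

section \<open>Meromorphic 1-forms with all residues zero\<close>

text \<open>A 1-form is given by its coefficient \<open>g\<close> in the affine coordinate \<open>x\<close>, i.e. it is \<open>g dx\<close>;
  \<open>form_coeff g p\<close> is its coefficient in the local parameter \<open>chart p\<close> (at infinity,
  \<open>x = 1/t\<close> and \<open>dx = - dt / t^2\<close>).\<close>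

definition form_coeff :: "(complex \<Rightarrow> complex) \<Rightarrow> cp1 \<Rightarrow> complex \<Rightarrow> complex" where
  "form_coeff g p t = (case p of Fin a \<Rightarrow> g (a + t) | Infty \<Rightarrow> - g (1 / t) / t ^ 2)"

definition residueless :: "(complex \<Rightarrow> complex) \<Rightarrow> bool" where
  "residueless g \<longleftrightarrow>
     (\<forall>p. form_coeff g p meromorphic_on {0} \<and> residue (form_coeff g p) 0 = 0)"

lemma residueless_iff:
  "residueless g \<longleftrightarrow> (\<forall>p. \<exists>F. form_coeff g p has_laurent_expansion F \<and> fls_residue F = 0)"
  unfolding residueless_def meromorphic_on_def
  using has_laurent_expansion_residue_0 by fastforce

lemma form_coeff_lin: "form_coeff (\<lambda>x. c * f x + d * g x) p = (\<lambda>t. c * form_coeff f p t + d * form_coeff g p t)"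
  by (cases p) (auto simp: form_coeff_def fun_eq_iff add_divide_distrib diff_divide_distrib)

lemma residueless_lin:
  assumes "residueless f" "residueless g" shows "residueless (\<lambda>x. c * f x + d * g x)"
  unfolding residueless_iff form_coeff_lin
proof
  fix p
  obtain F G where "form_coeff f p has_laurent_expansion F" "fls_residue F = 0"
    "form_coeff g p has_laurent_expansion G" "fls_residue G = 0"
    using assms unfolding residueless_iff by metis
  then show "\<exists>H. (\<lambda>t. c * form_coeff f p t + d * form_coeff g p t) has_laurent_expansion H \<and>
      fls_residue H = 0"
    by (intro exI[of _ "fls_const c * F + fls_const d * G"])
       (auto intro!: laurent_expansion_intros)
qed

lemma residueless_0: "residueless (\<lambda>x. 0)"
proof -
  have "form_coeff (\<lambda>x. 0) p = (\<lambda>t. 0)" for p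
    by (cases p) (auto simp: form_coeff_def)
  then show ?thesis by (auto simp: residueless_iff intro!: exI[of _ 0])
qed

text \<open>The space \<open>K\<close>: two meromorphic coefficients are identified if they differ only at finitely
  many points, so that no convention for the values at the poles is needed.\<close>

definition form_rel :: "(complex \<Rightarrow> complex) \<Rightarrow> (complex \<Rightarrow> complex) \<Rightarrow> bool" where
  "form_rel f g \<longleftrightarrow> residueless f \<and> residueless g \<and> finite {x. f x \<noteq> g x}"

quotient_type kform = "complex \<Rightarrow> complex" / partial: form_rel
proof (rule part_equivpI)
  show "\<exists>x. form_rel x x" by (intro exI[of _ "\<lambda>x. 0"]) (simp add: form_rel_def residueless_0)
  show "symp form_rel" by (auto simp: form_rel_def symp_def eq_commute)
  show "transp form_rel"
  proof (rule transpI)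
    fix f g h assume "form_rel f g" "form_rel g h"
    moreover have "{x. f x \<noteq> h x} \<subseteq> {x. f x \<noteq> g x} \<union> {x. g x \<noteq> h x}" by auto
    ultimately show "form_rel f h"
      by (auto simp: form_rel_def intro: finite_subset)
  qed
qed

lemma form_rel_lin:
  assumes "form_rel f f'" "form_rel g g'"
  shows "form_rel (\<lambda>x. c * f x + d * g x) (\<lambda>x. c * f' x + d * g' x)"
proof -
  have "{x. c * f x + d * g x \<noteq> c * f' x + d * g' x} \<subseteq> {x. f x \<noteq> f' x} \<union> {x. g x \<noteq> g' x}"
    by auto
  then show ?thesis
    using assms by (auto simp: form_rel_def residueless_lin intro: finite_subset)
qed

instantiation kform :: ab_group_add
begin

lift_definition zero_kform :: kform is "\<lambda>x. 0"
  by (simp add: form_rel_def residueless_0)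

lift_definition plus_kform :: "kform \<Rightarrow> kform \<Rightarrow> kform" is "\<lambda>f g x. f x + g x"
  using form_rel_lin[where c = 1 and d = 1] by simp

lift_definition uminus_kform :: "kform \<Rightarrow> kform" is "\<lambda>f x. - f x"
  using form_rel_lin[where c = "-1" and d = 0] by simp

lift_definition minus_kform :: "kform \<Rightarrow> kform \<Rightarrow> kform" is "\<lambda>f g x. f x - g x"
  using form_rel_lin[where c = 1 and d = "-1"] by simp

instance
proof
  fix a b c :: kform
  show "a + b + c = a + (b + c)"
    by transfer (auto simp: form_rel_def residueless_lin[where c = 1 and d = 1, simplified] add.assoc)
  show "a + b = b + a"
    by transfer (auto simp: form_rel_def residueless_lin[where c = 1 and d = 1, simplified] add.commute)
  show "0 + a = a"
    by transfer (auto simp: form_rel_def)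
  show "- a + a = 0"
    by transfer (auto simp: form_rel_def residueless_0)
  show "a - b = a + - b"
    by transfer (auto simp: form_rel_def residueless_lin[where c = 1 and d = "-1", simplified])
qed

end

lift_definition scale_form :: "complex \<Rightarrow> kform \<Rightarrow> kform" is "\<lambda>c f x. c * f x"
  using form_rel_lin[where d = 0] by simp

lemma form_rel_eventually:
  assumes "form_rel f g" shows "eventually (\<lambda>t. form_coeff f p t = form_coeff g p t) (at 0)"
proof -
  have fin: "finite {x. f x \<noteq> g x}" using assms by (simp add: form_rel_def)
  define S where "S = (case p of Fin a \<Rightarrow> (\<lambda>x. x - a) ` {x. f x \<noteq> g x} | Infty \<Rightarrow> (\<lambda>x. 1 / x) ` {x. f x \<noteq> g x})"
  have "finite S" using fin by (cases p) (auto simp: S_def)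
  then have "eventually (\<lambda>t. t \<notin> S) (at 0)"
    using islimpt_finite islimpt_iff_eventually by metis
  then show ?thesis
    by (rule eventually_mono) (cases p; force simp: S_def form_coeff_def image_iff)
qed

text \<open>The form has no pole at the point.\<close>

lift_definition regular_at :: "cp1 \<Rightarrow> kform \<Rightarrow> bool" is "\<lambda>p f. \<not> is_pole (form_coeff f p) 0"
  using form_rel_eventually is_pole_cong by blast

text \<open>The constant Laurent coefficient of a form in the local parameter at the point. At a point
  where the form is regular this is its value (lemma \<open>const_coeff_regular\<close>); at a
  pole it is merely a convention, which has the advantage of being linear in the form.\<close>

lift_definition const_coeff :: "cp1 \<Rightarrow> kform \<Rightarrow> complex" is
  "\<lambda>p f. fls_nth (laurent_expansion (form_coeff f p) 0) 0"
  using form_rel_eventually laurent_expansion_cong by metis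


lemma const_coeff_regular:
  assumes "residueless f" "form_coeff f p \<midarrow>0\<rightarrow> c"
  shows "const_coeff p (abs_kform f) = c"
proof -
  have "form_rel f f" using assms(1) by (simp add: form_rel_def)
  then have 1: "const_coeff p (abs_kform f) = fls_nth (laurent_expansion (form_coeff f p) 0) 0"
    by (rule const_coeff.abs_eq)
  define F where "F = laurent_expansion (form_coeff f p) 0"
  have F: "form_coeff f p has_laurent_expansion F"
    using assms(1) laurent_expansion_0_eqI unfolding residueless_iff F_def by metis
  have "\<not> is_pole (form_coeff f p) 0"
    using assms(2) not_tendsto_and_filterlim_at_infinity[of "at (0::complex)"]
    by (auto simp: is_pole_def)
  then have "fls_subdegree F \<ge> 0"
    using has_laurent_expansion_imp_is_pole_0[OF F] by force
  then have "form_coeff f p \<midarrow>0\<rightarrow> fls_nth F 0"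
    using F has_laurent_expansion_imp_tendsto_0 by blast
  then have "fls_nth F 0 = c"
    using assms(2) LIM_unique by blast
  with 1 show ?thesis by (simp add: F_def)
qed

lemma const_coeff_add: "const_coeff p (a + b) = const_coeff p a + const_coeff p b"
  and const_coeff_scale: "const_coeff p (scale_form c a) = c * const_coeff p a"
proof -
  have *: "fls_nth (laurent_expansion (form_coeff (\<lambda>x. c * f x + d * g x) p) 0) 0 =
     c * fls_nth (laurent_expansion (form_coeff f p) 0) 0 +
     d * fls_nth (laurent_expansion (form_coeff g p) 0) 0"
    if fg: "residueless f" "residueless g" for c d f g and p
  proof -
    obtain F G where FG: "form_coeff f p has_laurent_expansion F"
      "form_coeff g p has_laurent_expansion G"
      using fg unfolding residueless_iff by metis
    then have "form_coeff (\<lambda>x. c * f x + d * g x) p has_laurent_expansion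
        fls_const c * F + fls_const d * G"
      unfolding form_coeff_lin by (intro laurent_expansion_intros)
    with FG show ?thesis
      by (simp add: laurent_expansion_0_eqI)
  qed
  show "const_coeff p (a + b) = const_coeff p a + const_coeff p b"
    by transfer (use *[where c = 1 and d = 1] in \<open>auto simp: form_rel_def\<close>)
  show "const_coeff p (scale_form c a) = c * const_coeff p a"
    by transfer (use *[where d = 0] in \<open>auto simp: form_rel_def\<close>)
qed

text \<open>The coefficient of \<open>du\<^sub>p\<close> in the value \<open>\<alpha>(p)\<close>.\<close>

definition form_val :: "(cp1 \<Rightarrow> complex) \<Rightarrow> cp1 \<Rightarrow> kform \<Rightarrow> complex" where
  "form_val u p \<alpha> = const_coeff p \<alpha> / deriv (u \<circ> chart p) 0"

lemma form_val_add: "form_val u p (a + b) = form_val u p a + form_val u p b"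
  and form_val_scale: "form_val u p (scale_form c a) = c * form_val u p a"
  by (simp_all add: form_val_def const_coeff_add const_coeff_scale add_divide_distrib)

text \<open>The form \<open>- du / (u - u(z))^2\<close>.\<close>

definition e_form :: "(cp1 \<Rightarrow> complex) \<Rightarrow> cp1 \<Rightarrow> kform" where
  "e_form u z = abs_kform (\<lambda>x. - deriv (\<lambda>y. u (Fin y)) x / (u (Fin x) - u z) ^ 2)"

text \<open>The form is exact, hence in \<open>K\<close>.\<close>

lemma residueless_e_form:
  assumes "is_coordinate u P"
  shows "residueless (\<lambda>x. - deriv (\<lambda>y. u (Fin y)) x / (u (Fin x) - c) ^ 2)"
    (is "residueless ?g")
  unfolding residueless_iff
proof
  fix p
  define U where "U = u \<circ> chart p"
  define W where "W t = inverse (U t - c)" for t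
  have mero: "U meromorphic_on {0}"
    using assms by (simp add: is_coordinate_def U_def)
  then obtain L where L: "U has_laurent_expansion L"
    by (auto simp: meromorphic_on_def)
  have Lc: "(\<lambda>t. U t - c) has_laurent_expansion L - fls_const c"
    by (intro laurent_expansion_intros L)
  then have W: "W has_laurent_expansion inverse (L - fls_const c)"
    unfolding W_def by (rule has_laurent_expansion_inverse)
  have D: "deriv W has_laurent_expansion fls_deriv (inverse (L - fls_const c))"
    by (rule has_laurent_expansion_deriv[OF W])
  have "isolated_singularity_at U 0"
    using mero meromorphic_at_iff by blast
  then have an: "eventually (\<lambda>t. U analytic_on {t}) (at 0)"
    unfolding isolated_singularity_at_def eventually_at
    by clarsimp (metis analytic_on_analytic_at Diff_iff mem_ball_0 singletonD)
  have chain: "form_coeff ?g p t = - deriv U t / (U t - c) ^ 2"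
    if t: "t \<noteq> 0" "U analytic_on {t}" for t
  proof (cases p)
    case (Fin a)
    have U: "U = (\<lambda>y. u (Fin y)) \<circ> (\<lambda>s. a + s)" by (auto simp: U_def chart_def Fin)
    have "deriv (\<lambda>y. u (Fin y)) (a + t) = deriv U t"
      unfolding U deriv_shift_0[of _ "a + t"] deriv_shift_0[of _ t] by (simp add: o_def add_ac)
    then show ?thesis by (simp add: form_coeff_def Fin U)
  next
    case Infty
    have Ut: "U t = u (Fin (1 / t))" using t by (simp add: U_def chart_def Infty)
    have "(U has_field_derivative deriv U t) (at (1 / (1 / t)))"
      using t analytic_on_imp_differentiable_at DERIV_deriv_iff_field_differentiable by fastforce
    moreover have "((\<lambda>y. 1 / y) has_field_derivative (- (t ^ 2))) (at (1 / t))"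
      using t by (auto intro!: derivative_eq_intros simp: power2_eq_square)
    ultimately have "((\<lambda>y. U (1 / y)) has_field_derivative (deriv U t * (- (t ^ 2)))) (at (1 / t))"
      by (rule DERIV_chain2)
    moreover have "eventually (\<lambda>y. U (1 / y) = u (Fin y)) (nhds (1 / t))"
      by (rule eventually_mono[OF t1_space_nhds[of "1 / t" 0]])
         (use t in \<open>auto simp: U_def chart_def Infty\<close>)
    ultimately have "((\<lambda>y. u (Fin y)) has_field_derivative (deriv U t * (- (t ^ 2)))) (at (1 / t))"
      by (subst (asm) DERIV_cong_ev) auto
    then have "deriv (\<lambda>y. u (Fin y)) (1 / t) = deriv U t * (- (t ^ 2))"
      by (rule DERIV_imp_deriv)
    then show ?thesis using t(1) by (simp add: form_coeff_def Infty Ut field_simps)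
  qed
  have "eventually (\<lambda>t. deriv W t = form_coeff ?g p t) (at 0)"
  proof (cases "L - fls_const c = 0")
    case True
    then have "eventually (\<lambda>t. U t - c = 0) (at 0)"
      using has_laurent_expansion_eventually_zero_iff[of "\<lambda>t. U t - c" 0] Lc by simp
    then obtain S where S: "open S" "0 \<in> S" "\<And>t. t \<in> S - {0} \<Longrightarrow> U t - c = 0"
      unfolding eventually_at_topological by blast
    then have "eventually (\<lambda>t. t \<in> S - {0}) (at 0)"
      using eventually_at_in_open by blast
    moreover have "eventually (\<lambda>s. U s - c = 0) (nhds t)" if "t \<in> S - {0}" for t
      unfolding eventually_nhds using S that by (intro exI[of _ "S - {0}"]) (auto simp: open_delete)
    ultimately have "eventually (\<lambda>t. eventually (\<lambda>s. U s - c = 0) (nhds t)) (at 0)"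
      by (auto elim: eventually_mono)
    then show ?thesis
      using an eventually_neq_at_within[of 0]
    proof eventually_elim
      case (elim t)
      then have "deriv W t = deriv (\<lambda>_. 0) t"
        by (intro deriv_cong_ev) (auto simp: W_def elim: eventually_mono)
      moreover have "U t - c = 0" using elim(1) eventually_nhds_x_imp_x by blast
      moreover note chain[OF elim(3,2)]
      ultimately show ?case by (simp del: minus_divide_left)
    qed
  next
    case False
    have "eventually (\<lambda>t. U t - c \<noteq> 0) (at 0)"
      using has_laurent_expansion_nonzero_imp_eventually_nonzero[OF Lc False] .
    then show ?thesis
      using an eventually_neq_at_within[of 0]
    proof eventually_elim
      case (elim t)
      have "(U has_field_derivative deriv U t) (at t)"
        using elim analytic_on_imp_differentiable_at DERIV_deriv_iff_field_differentiable by fastforce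
      then have "(W has_field_derivative (- deriv U t / (U t - c) ^ 2)) (at t)"
        unfolding W_def using elim
        by (auto intro!: derivative_eq_intros simp: field_simps power2_eq_square)
      then show ?case using chain[OF elim(3,2)] by (simp only: DERIV_imp_deriv)
    qed
  qed
  then have "deriv W has_laurent_expansion fls_deriv (inverse (L - fls_const c)) \<longleftrightarrow>
      form_coeff ?g p has_laurent_expansion fls_deriv (inverse (L - fls_const c))"
    by (intro has_laurent_expansion_cong refl)
  with D show "\<exists>F. form_coeff ?g p has_laurent_expansion F \<and> fls_residue F = 0"
    by (intro exI[of _ "fls_deriv (inverse (L - fls_const c))"]) (simp only: fls_residue_deriv simp_thms)
qed

section \<open>The symmetric algebra\<close>

text \<open>The free commutative algebra on the set of forms, modulo the ideal that makes the
  inclusion of the forms linear.\<close>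

type_synonym free_alg = "kform multiset \<Rightarrow>\<^sub>0 complex"

abbreviation gen :: "kform \<Rightarrow> free_alg" where
  "gen \<alpha> \<equiv> Poly_Mapping.single {#\<alpha>#} 1"

abbreviation cst :: "complex \<Rightarrow> free_alg" where
  "cst c \<equiv> Poly_Mapping.single {#} c"

inductive_set sym_ideal :: "free_alg set" where
  gen_add: "gen (\<alpha> + \<beta>) - (gen \<alpha> + gen \<beta>) \<in> sym_ideal"
| gen_scale: "gen (scale_form c \<alpha>) - cst c * gen \<alpha> \<in> sym_ideal"
| zero: "0 \<in> sym_ideal"
| add: "p \<in> sym_ideal \<Longrightarrow> q \<in> sym_ideal \<Longrightarrow> p + q \<in> sym_ideal"
| mult: "p \<in> sym_ideal \<Longrightarrow> q * p \<in> sym_ideal"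

lemma sym_ideal_uminus: "p \<in> sym_ideal \<Longrightarrow> - p \<in> sym_ideal"
  using sym_ideal.mult[of p "-1"] by simp

lemma sym_ideal_mult_right: "p \<in> sym_ideal \<Longrightarrow> p * q \<in> sym_ideal"
  using sym_ideal.mult[of p q] by (simp add: mult.commute)

definition sym_rel :: "free_alg \<Rightarrow> free_alg \<Rightarrow> bool" where
  "sym_rel p q \<longleftrightarrow> p - q \<in> sym_ideal"

text \<open>The linear extension of a map on monomials, with \<open>s\<close> the scalar embedding.\<close>

definition lin_ext :: "(complex \<Rightarrow> 'b::comm_ring_1) \<Rightarrow> (kform multiset \<Rightarrow> 'b) \<Rightarrow> free_alg \<Rightarrow> 'b" where
  "lin_ext s f p = (\<Sum>M\<in>Poly_Mapping.keys p. s (Poly_Mapping.lookup p M) * f M)"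

lemma lin_ext_superset:
  assumes "s 0 = 0" "finite A" "Poly_Mapping.keys p \<subseteq> A"
  shows "lin_ext s f p = (\<Sum>M\<in>A. s (Poly_Mapping.lookup p M) * f M)"
  unfolding lin_ext_def using assms
  by (intro sum.mono_neutral_left) (auto simp: in_keys_iff)

lemma lin_ext_add:
  assumes "s 0 = 0" "\<And>a b. s (a + b) = s a + s b"
  shows "lin_ext s f (p + q) = lin_ext s f p + lin_ext s f q"
proof -
  let ?A = "Poly_Mapping.keys p \<union> Poly_Mapping.keys q"
  have "lin_ext s f r = (\<Sum>M\<in>?A. s (Poly_Mapping.lookup r M) * f M)" if "r \<in> {p, q, p + q}" for r
    using that keys_add[of p q] assms(1) by (intro lin_ext_superset) auto
  then show ?thesis
    by (simp add: lookup_add assms(2) algebra_simps sum.distrib)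
qed

lemma lin_ext_single:
  assumes "s 0 = 0"
  shows "lin_ext s f (Poly_Mapping.single M c) = s c * f M"
  using assms by (simp add: lin_ext_def)

text \<open>The sum over all bijections between the factors of a monomial and a list of points of the
  product of the values (zero if there is none).\<close>

fun form_perm :: "(cp1 \<Rightarrow> complex) \<Rightarrow> kform multiset \<Rightarrow> cp1 list \<Rightarrow> complex" where
  "form_perm u M [] = (if M = {#} then 1 else 0)"
| "form_perm u M (x # xs) = (\<Sum>\<alpha>\<in>#M. form_val u x \<alpha> * form_perm u (M - {#\<alpha>#}) xs)"

lemma form_perm_Cons_add:
  "form_perm u (add_mset \<alpha> M) (x # xs) = form_val u x \<alpha> * form_perm u M xs +
     (\<Sum>\<gamma>\<in>#M. form_val u x \<gamma> * form_perm u (add_mset \<alpha> (M - {#\<gamma>#})) xs)"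
proof -
  have "image_mset (\<lambda>\<gamma>. form_val u x \<gamma> * form_perm u (add_mset \<alpha> M - {#\<gamma>#}) xs) M
      = image_mset (\<lambda>\<gamma>. form_val u x \<gamma> * form_perm u (add_mset \<alpha> (M - {#\<gamma>#})) xs) M"
    by (intro image_mset_cong) (auto simp: add_mset_diff_bothsides insert_DiffM multiset_eq_iff)
  then show ?thesis by simp
qed

lemma form_perm_linear:
  "form_perm u (add_mset (\<alpha> + \<beta>) M) xs = form_perm u (add_mset \<alpha> M) xs + form_perm u (add_mset \<beta> M) xs"
  "form_perm u (add_mset (scale_form c \<alpha>) M) xs = c * form_perm u (add_mset \<alpha> M) xs"
proof (induction xs arbitrary: M)
  case (Cons x xs)
  case 1 show ?case
    by (simp only: form_perm_Cons_add Cons.IH form_val_add)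
       (simp add: algebra_simps sum_mset.distrib)
  case 2 show ?case
    by (simp only: form_perm_Cons_add Cons.IH form_val_scale)
       (simp add: algebra_simps sum_mset_distrib_left)
qed auto

text \<open>The degree \<open>m\<close> component as a symmetric polydifferential, evaluated at \<open>m\<close> auxiliary points
  \<open>xs\<close> and divided by the product of the \<open>du\<close> at these points: \<open>\<alpha>\<^sub>1 \<dots> \<alpha>\<^sub>m\<close> goes to the
  average of \<open>\<alpha>\<^sub>1(x\<^sub>\<sigma>\<^sub>1) \<dots> \<alpha>\<^sub>m(x\<^sub>\<sigma>\<^sub>m)\<close> over all permutations.\<close>

definition free_polydiff :: "(cp1 \<Rightarrow> complex) \<Rightarrow> free_alg \<Rightarrow> cp1 list \<Rightarrow> complex" where
  "free_polydiff u p xs = lin_ext (\<lambda>c. c) (\<lambda>M. form_perm u M xs / fact (length xs)) p"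

lemma free_polydiff_simps:
  "free_polydiff u (p + q) xs = free_polydiff u p xs + free_polydiff u q xs"
  "free_polydiff u (Poly_Mapping.single M c) xs = c * form_perm u M xs / fact (length xs)"
  "free_polydiff u 0 xs = 0"
  by (simp_all add: free_polydiff_def lin_ext_add lin_ext_single) (simp add: lin_ext_def)

lemma free_polydiff_minus:
  "free_polydiff u (p - q) xs = free_polydiff u p xs - free_polydiff u q xs"
  using free_polydiff_simps(1)[of u "p - q" q xs] by simp

lemma free_alg_induct [case_names single add]:
  fixes p :: free_alg
  assumes "\<And>M c. P (Poly_Mapping.single M c)" "\<And>p q. P p \<Longrightarrow> P q \<Longrightarrow> P (p + q)"
  shows "P p"
proof -
  have "P (\<Sum>M\<in>A. Poly_Mapping.single M (Poly_Mapping.lookup p M))" if "finite A" for A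
    using that
  proof (induction A)
    case empty
    show ?case using assms(1)[of "{#}" 0] by simp
  qed (simp add: assms)
  moreover have "(\<Sum>M\<in>Poly_Mapping.keys p. Poly_Mapping.single M (Poly_Mapping.lookup p M)) = p"
    by (rule poly_mapping_eqI)
       (auto simp: lookup_sum lookup_single when_def in_keys_iff)
  ultimately show ?thesis
    using finite_keys[of p] by metis
qed

lemma free_polydiff_ideal:
  assumes "p \<in> sym_ideal" shows "free_polydiff u (q * p) xs = 0"
  using assms
proof (induction arbitrary: q)
  case (gen_add \<alpha> \<beta>)
  show ?case
    by (induction q rule: free_alg_induct)
       (simp_all add: algebra_simps free_polydiff_simps free_polydiff_minus mult_single
          form_perm_linear add_divide_distrib)
next
  case (gen_scale c \<alpha>)
  show ?case
    by (induction q rule: free_alg_induct)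
       (simp_all add: algebra_simps free_polydiff_simps free_polydiff_minus mult_single
          form_perm_linear)
next
  case (mult p q')
  then show ?case by (metis mult.assoc)
qed (auto simp: algebra_simps free_polydiff_simps)

lemma free_polydiff_respects: "sym_rel p q \<Longrightarrow> free_polydiff u p = free_polydiff u q"
  using free_polydiff_ideal[of "p - q" u 1]
  by (auto simp: sym_rel_def free_polydiff_minus fun_eq_iff)

quotient_type symK = free_alg / sym_rel
proof (rule equivpI)
  show "reflp sym_rel" by (auto simp: reflp_def sym_rel_def sym_ideal.zero)
  show "symp sym_rel"
    unfolding symp_def sym_rel_def using sym_ideal_uminus by fastforce
  show "transp sym_rel"
    unfolding transp_def sym_rel_def using sym_ideal.add by fastforce
qed

instantiation symK :: comm_ring_1
begin

lift_definition zero_symK :: symK is 0 .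
lift_definition one_symK :: symK is 1 .
lift_definition plus_symK :: "symK \<Rightarrow> symK \<Rightarrow> symK" is "(+)"
  unfolding sym_rel_def using sym_ideal.add by (metis add_diff_add)
lift_definition uminus_symK :: "symK \<Rightarrow> symK" is uminus
  unfolding sym_rel_def using sym_ideal_uminus by fastforce
lift_definition minus_symK :: "symK \<Rightarrow> symK \<Rightarrow> symK" is minus
  unfolding sym_rel_def
  using sym_ideal.add sym_ideal_uminus by (smt (verit) add_diff_add diff_minus_eq_add minus_diff_eq add_uminus_conv_diff diff_diff_eq2 add.commute diff_add_eq)
lift_definition times_symK :: "symK \<Rightarrow> symK \<Rightarrow> symK" is times
proof -
  fix p p' q q' assume "sym_rel p p'" "sym_rel q q'"
  then have "(p - p') * q + p' * (q - q') \<in> sym_ideal"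
    unfolding sym_rel_def by (intro sym_ideal.add sym_ideal_mult_right sym_ideal.mult)
  then show "sym_rel (p * q) (p' * q')"
    by (simp add: sym_rel_def algebra_simps)
qed

instance
proof
  fix a b c :: symK
  show "a + b + c = a + (b + c)" by transfer (simp add: sym_rel_def sym_ideal.zero algebra_simps)
  show "a + b = b + a" by transfer (simp add: sym_rel_def sym_ideal.zero algebra_simps)
  show "0 + a = a" by transfer (simp add: sym_rel_def sym_ideal.zero algebra_simps)
  show "- a + a = 0" by transfer (simp add: sym_rel_def sym_ideal.zero algebra_simps)
  show "a - b = a + - b" by transfer (simp add: sym_rel_def sym_ideal.zero algebra_simps)
  show "a * b * c = a * (b * c)" by transfer (simp add: sym_rel_def sym_ideal.zero algebra_simps)
  show "a * b = b * a" by transfer (simp add: sym_rel_def sym_ideal.zero algebra_simps)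
  show "1 * a = a" by transfer (simp add: sym_rel_def sym_ideal.zero algebra_simps)
  show "(a + b) * c = a * c + b * c" by transfer (simp add: sym_rel_def sym_ideal.zero algebra_simps)
  show "(0::symK) \<noteq> 1"
  proof (transfer, rule notI)
    assume "sym_rel 0 1"
    then have "free_polydiff (\<lambda>_. 0) 0 [] = free_polydiff (\<lambda>_. 0) (cst 1) []"
      using free_polydiff_respects by fastforce
    then show False by (simp only: free_polydiff_simps) simp
  qed
qed

end

lift_definition of_form :: "kform \<Rightarrow> symK" is gen .

lift_definition of_scalar :: "complex \<Rightarrow> symK" is cst .


lift_definition polydiff :: "(cp1 \<Rightarrow> complex) \<Rightarrow> symK \<Rightarrow> cp1 list \<Rightarrow> complex" is free_polydiff
  by (rule free_polydiff_respects)

text \<open>The subalgebra generated by the forms regular at \<open>z\<close>.\<close>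

inductive_set Wreg :: "cp1 \<Rightarrow> symK set" for z where
  scalar: "of_scalar c \<in> Wreg z"
| form: "regular_at z \<alpha> \<Longrightarrow> of_form \<alpha> \<in> Wreg z"
| add: "v \<in> Wreg z \<Longrightarrow> w \<in> Wreg z \<Longrightarrow> v + w \<in> Wreg z"
| mult: "v \<in> Wreg z \<Longrightarrow> w \<in> Wreg z \<Longrightarrow> v * w \<in> Wreg z"

section \<open>The fields\<close>

text \<open>Since \<open>z\<close> avoids the pole of \<open>u\<close>, the fibres of the canonical bundle and its powers are
  trivialised by \<open>du\<^sub>z\<close>; the operators are given by their coefficients.\<close>

definition e_hat :: "(cp1 \<Rightarrow> complex) \<Rightarrow> cp1 \<Rightarrow> symK \<Rightarrow> symK" where
  "e_hat u z v = of_form (e_form u z) * v"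

definition is_contraction :: "(cp1 \<Rightarrow> complex) \<Rightarrow> cp1 \<Rightarrow> (symK \<Rightarrow> symK) \<Rightarrow> bool" where
  "is_contraction u z D \<longleftrightarrow>
     (\<forall>v\<in>Wreg z. D v \<in> Wreg z) \<and>
     (\<forall>v\<in>Wreg z. \<forall>w\<in>Wreg z. D (v + w) = D v + D w) \<and>
     (\<forall>v\<in>Wreg z. \<forall>c. D (of_scalar c * v) = of_scalar c * D v) \<and>
     (\<forall>v\<in>Wreg z. \<forall>w\<in>Wreg z. D (v * w) = D v * w + v * D w) \<and>
     D 1 = 0 \<and>
     (\<forall>\<alpha>. regular_at z \<alpha> \<longrightarrow> D (of_form \<alpha>) = of_scalar (- form_val u z \<alpha>))"

text \<open>Existence: since \<open>form_val\<close> is linear on all forms, a derivation of the free algebra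
  descends to the quotient and restricts to \<open>Wreg z\<close>.\<close>

definition free_deriv :: "(kform \<Rightarrow> complex) \<Rightarrow> free_alg \<Rightarrow> free_alg" where
  "free_deriv \<phi> = lin_ext cst (\<lambda>M. \<Sum>\<alpha>\<in>#M. cst (\<phi> \<alpha>) * Poly_Mapping.single (M - {#\<alpha>#}) 1)"

lemma free_deriv_add: "free_deriv \<phi> (p + q) = free_deriv \<phi> p + free_deriv \<phi> q"
  unfolding free_deriv_def by (rule lin_ext_add) (simp_all add: single_add)

lemma free_deriv_single: "free_deriv \<phi> (Poly_Mapping.single M c) =
    cst c * (\<Sum>\<alpha>\<in>#M. cst (\<phi> \<alpha>) * Poly_Mapping.single (M - {#\<alpha>#}) 1)"
  unfolding free_deriv_def by (rule lin_ext_single) simp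

lemma free_deriv_monom_mult:
  "(\<Sum>\<alpha>\<in>#M. cst (\<phi> \<alpha>) * Poly_Mapping.single (M + N - {#\<alpha>#}) 1) =
   (\<Sum>\<alpha>\<in>#M. cst (\<phi> \<alpha>) * Poly_Mapping.single (M - {#\<alpha>#}) 1) * Poly_Mapping.single N (1::complex)"
proof -
  have "image_mset (\<lambda>\<alpha>. cst (\<phi> \<alpha>) * Poly_Mapping.single (M + N - {#\<alpha>#}) 1) M =
        image_mset (\<lambda>\<alpha>. cst (\<phi> \<alpha>) * Poly_Mapping.single (M - {#\<alpha>#}) 1 * Poly_Mapping.single N (1::complex)) M"
    by (intro image_mset_cong) (simp add: mult_single)
  then show ?thesis by (simp add: sum_mset_distrib_right)
qed

lemma free_deriv_mult: "free_deriv \<phi> (p * q) = free_deriv \<phi> p * q + p * free_deriv \<phi> q"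
proof (induction p rule: free_alg_induct)
  case (single M c)
  show ?case
  proof (induction q rule: free_alg_induct)
    case (single N d)
    have 1: "Poly_Mapping.single M c = cst c * Poly_Mapping.single M 1"
      "Poly_Mapping.single N d = cst d * Poly_Mapping.single N 1"
      "cst (c * d) = cst c * cst d" by (simp_all add: mult_single)
    have 2: "(\<Sum>\<alpha>\<in>#M + N. cst (\<phi> \<alpha>) * Poly_Mapping.single (M + N - {#\<alpha>#}) 1) =
      (\<Sum>\<alpha>\<in>#M. cst (\<phi> \<alpha>) * Poly_Mapping.single (M - {#\<alpha>#}) 1) * Poly_Mapping.single N 1 +
      (\<Sum>\<alpha>\<in>#N. cst (\<phi> \<alpha>) * Poly_Mapping.single (N - {#\<alpha>#}) 1) * Poly_Mapping.single M 1"
      using free_deriv_monom_mult[of \<phi> M N] free_deriv_monom_mult[of \<phi> N M]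
      by (simp add: add.commute)
    have "free_deriv \<phi> (Poly_Mapping.single M c * Poly_Mapping.single N d) =
       cst (c * d) * (\<Sum>\<alpha>\<in>#M + N. cst (\<phi> \<alpha>) * Poly_Mapping.single (M + N - {#\<alpha>#}) 1)"
      by (simp only: mult_single free_deriv_single)
    also have "\<dots> = free_deriv \<phi> (Poly_Mapping.single M c) * Poly_Mapping.single N d +
       Poly_Mapping.single M c * free_deriv \<phi> (Poly_Mapping.single N d)"
      unfolding 2 free_deriv_single 1(3) by (subst 1(1), subst 1(2)) (simp only: ring_distribs mult_ac)
    finally show ?case .
  next
    case (add p q) then show ?case by (simp add: algebra_simps free_deriv_add)
  qed
next
  case (add p q) then show ?case by (simp add: algebra_simps free_deriv_add)
qed

lemma free_deriv_diff: "free_deriv \<phi> (p - q) = free_deriv \<phi> p - free_deriv \<phi> q"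
  using free_deriv_add[of \<phi> "p - q" q] by simp

lemma free_deriv_ideal:
  assumes "\<And>a b. \<phi> (a + b) = \<phi> a + \<phi> b" "\<And>c a. \<phi> (scale_form c a) = c * \<phi> a"
    and "p \<in> sym_ideal"
  shows "free_deriv \<phi> p \<in> sym_ideal"
  using assms(3)
proof induction
  case (gen_add \<alpha> \<beta>)
  show ?case
    by (simp add: free_deriv_add free_deriv_diff free_deriv_single assms mult_single single_add sym_ideal.zero)
next
  case (gen_scale c \<alpha>)
  show ?case
    by (simp add: free_deriv_mult free_deriv_diff free_deriv_single assms mult_single sym_ideal.zero)
next
  case zero
  then show ?case using free_deriv_diff[of \<phi> 0 0] by (simp add: sym_ideal.zero)
qed (auto simp: free_deriv_add free_deriv_mult intro: sym_ideal.add sym_ideal.mult sym_ideal_mult_right)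

lemma of_scalar_mult: "of_scalar (a * b) = of_scalar a * of_scalar b"
  by transfer (simp add: mult_single sym_rel_def sym_ideal.zero)

lemma of_scalar_1: "of_scalar 1 = 1"
  by transfer (simp add: sym_rel_def sym_ideal.zero)

lemma one_Wreg: "1 \<in> Wreg z"
  using Wreg.scalar[of 1 z] by (simp add: of_scalar_1)

lemma is_contraction_exists: "\<exists>D. is_contraction u z D"
proof -
  define \<phi> where "\<phi> a = - form_val u z a" for a
  have lin: "\<phi> (a + b) = \<phi> a + \<phi> b" "\<phi> (scale_form c a) = c * \<phi> a" for a b c
    by (simp_all add: \<phi>_def form_val_add form_val_scale)
  have resp: "sym_rel (free_deriv \<phi> p) (free_deriv \<phi> q)" if "sym_rel p q" for p q
    using free_deriv_ideal[OF lin, of "p - q"] that by (simp add: sym_rel_def free_deriv_diff)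
  define D where "D v = abs_symK (free_deriv \<phi> (rep_symK v))" for v
  have D_abs: "D (abs_symK p) = abs_symK (free_deriv \<phi> p)" for p
    unfolding D_def by (intro symK.abs_eq_iff[THEN iffD2] resp rep_abs_rsp_left[OF Quotient3_symK])
       (use symK.abs_eq_iff in blast)
  have ex: "\<exists>p. v = abs_symK p" for v
    by (metis Quotient3_abs_rep[OF Quotient3_symK])
  have add: "D (v + w) = D v + D w" for v w
    using ex[of v] ex[of w] by (auto simp: D_abs plus_symK.abs_eq free_deriv_add)
  have mult: "D (v * w) = D v * w + v * D w" for v w
    using ex[of v] ex[of w]
    by (auto simp: D_abs plus_symK.abs_eq times_symK.abs_eq free_deriv_mult)
  have sc: "D (of_scalar c) = 0" for c
    by (simp add: of_scalar.abs_eq D_abs free_deriv_single zero_symK_def)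
  have fm: "D (of_form \<alpha>) = of_scalar (- form_val u z \<alpha>)" for \<alpha>
    by (simp add: of_form.abs_eq of_scalar.abs_eq D_abs free_deriv_single \<phi>_def mult_single)
  have "D v \<in> Wreg z" if "v \<in> Wreg z" for v
    using that
  proof induction
    case (scalar c)
    have "of_scalar 0 = 0" by (simp add: of_scalar.abs_eq zero_symK_def)
    then show ?case using Wreg.scalar[of 0 z] by (simp add: sc)
  qed (auto simp: add mult fm intro: Wreg.intros)
  then have "is_contraction u z D"
    using sc[of 1] by (auto simp: is_contraction_def add mult sc fm of_scalar_1)
  then show ?thesis by blast
qed

lemma is_contraction_unique:
  assumes "is_contraction u z D" "is_contraction u z D'" "v \<in> Wreg z"
  shows "D v = D' v"
  using assms(3)
proof induction
  case (scalar c)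
  have "D (of_scalar c * 1) = 0" "D' (of_scalar c * 1) = 0"
    using assms(1,2) one_Wreg unfolding is_contraction_def by (metis mult_zero_right)+
  then show ?case by simp
qed (use assms(1,2) in \<open>auto simp: is_contraction_def\<close>)

lemma contraction_ex1:
  "\<exists>!D. is_contraction u z D \<and> (\<forall>v. v \<notin> Wreg z \<longrightarrow> D v = 0)"
proof -
  obtain D where D: "is_contraction u z D" using is_contraction_exists by blast
  have "is_contraction u z (\<lambda>v. if v \<in> Wreg z then D v else 0)"
    using D one_Wreg Wreg.intros unfolding is_contraction_def by auto
  then show ?thesis
  proof (intro ex1I[where a = "\<lambda>v. if v \<in> Wreg z then D v else 0"])
    fix D' assume D': "is_contraction u z D' \<and> (\<forall>v. v \<notin> Wreg z \<longrightarrow> D' v = 0)"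
    show "D' = (\<lambda>v. if v \<in> Wreg z then D v else 0)"
    proof
      fix v
      show "D' v = (if v \<in> Wreg z then D v else 0)"
        using D' is_contraction_unique[OF _ D, of D' v] by simp
    qed
  qed simp
qed

text \<open>Outside its domain \<open>Wreg z\<close> the derivation is set to \<open>0\<close>; it is well defined
  by lemma \<open>contraction_ex1\<close>.\<close>

definition i_hat :: "(cp1 \<Rightarrow> complex) \<Rightarrow> cp1 \<Rightarrow> symK \<Rightarrow> symK" where
  "i_hat u z = (THE D. is_contraction u z D \<and> (\<forall>v. v \<notin> Wreg z \<longrightarrow> D v = 0))"

definition b_hat :: "(cp1 \<Rightarrow> complex) \<Rightarrow> cp1 \<Rightarrow> symK \<Rightarrow> symK" where
  "b_hat u z v = i_hat u z v + e_hat u z v"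

definition T_hat :: "(cp1 \<Rightarrow> complex) \<Rightarrow> cp1 \<Rightarrow> symK \<Rightarrow> symK" where
  "T_hat u z v = of_scalar (1 / 2) *
     (i_hat u z (i_hat u z v) + e_hat u z (e_hat u z v) + 2 * e_hat u z (i_hat u z v))"

definition S_hat :: "(cp1 \<Rightarrow> complex) \<Rightarrow> cp1 \<Rightarrow> symK \<Rightarrow> symK" where
  "S_hat u z v =
     e_hat u z (e_hat u z (e_hat u z v)) + 3 * e_hat u z (e_hat u z (i_hat u z v)) +
     3 * e_hat u z (i_hat u z (i_hat u z v)) + i_hat u z (i_hat u z (i_hat u z v))"

text \<open>The \<open>k\<close>-th derivative of the field \<open>b\<close> along \<open>d/du\<close>, applied to \<open>v\<close>, as a polydifferential:
  derivatives of families of polydifferentials are taken with the auxiliary points fixed.\<close>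

definition b_hat_deriv :: "(cp1 \<Rightarrow> complex) \<Rightarrow> nat \<Rightarrow> cp1 \<Rightarrow> symK \<Rightarrow> cp1 list \<Rightarrow> complex" where
  "b_hat_deriv u k z v xs = (ddu u ^^ k) (\<lambda>z. polydiff u (b_hat u z v) xs) z"

section \<open>Limits of polydifferentials depending on a point\<close>

text \<open>Polynomials in a parameter \<open>t\<close> and \<open>m\<close> further variables.\<close>

inductive poly_fun :: "nat \<Rightarrow> (complex \<Rightarrow> complex list \<Rightarrow> complex) \<Rightarrow> bool" for m where
  const: "poly_fun m (\<lambda>t ys. c)"
| param: "poly_fun m (\<lambda>t ys. t)"
| var: "i < m \<Longrightarrow> poly_fun m (\<lambda>t ys. ys ! i)"
| add: "poly_fun m f \<Longrightarrow> poly_fun m g \<Longrightarrow> poly_fun m (\<lambda>t ys. f t ys + g t ys)"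
| mult: "poly_fun m f \<Longrightarrow> poly_fun m g \<Longrightarrow> poly_fun m (\<lambda>t ys. f t ys * g t ys)"

text \<open>The degree \<open>m\<close> parts of the family \<open>E\<close> and of \<open>L\<close> are polydifferentials, written in the
  coordinates \<open>u\<close> of the points. The family is a rational function \<open>A / B\<close> of the points whose
  denominator does not vanish identically on \<open>z\<^sub>2 = z\<^sub>1\<close> (so there is no pole along this divisor),
  and the restriction of \<open>A / B\<close> to it is \<open>L\<close>. As usual, equality of rational functions means
  equality where the denominators do not vanish.\<close>

definition has_polydiff_limit ::
  "(cp1 \<Rightarrow> complex) \<Rightarrow> cp1 \<Rightarrow> cp1 set \<Rightarrow> nat \<Rightarrow> cp1 \<Rightarrow>
     (cp1 \<Rightarrow> cp1 list \<Rightarrow> complex) \<Rightarrow> (cp1 list \<Rightarrow> complex) \<Rightarrow> bool" where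
  "has_polydiff_limit u P N m z1 E L \<longleftrightarrow>
     (\<exists>A B. poly_fun m A \<and> poly_fun m B \<and>
        (\<exists>ys. length ys = m \<and> B (u z1) ys \<noteq> 0) \<and>
        (\<forall>z2 xs. z2 \<in> N - {z1} \<longrightarrow> length xs = m \<longrightarrow> P \<notin> set xs \<longrightarrow> B (u z2) (map u xs) \<noteq> 0 \<longrightarrow>
           E z2 xs = A (u z2) (map u xs) / B (u z2) (map u xs)) \<and>
        (\<forall>xs. length xs = m \<longrightarrow> P \<notin> set xs \<longrightarrow> B (u z1) (map u xs) \<noteq> 0 \<longrightarrow>
           L xs = A (u z1) (map u xs) / B (u z1) (map u xs)))"

end

theory Submission
  imports Defs
begin

text \<open>
  Write \<open>i\<^sub>k\<close>, \<open>e\<^sub>k\<close>, \<open>b\<^sub>k\<close> for the fields at \<open>z\<^sub>k\<close>. The contraction \<open>i\<^sub>2\<close> is a derivation, and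
  \<open>i\<^sub>2\<close> maps the form \<open>e\<^sub>1\<close> to \<open>1 / (u(z\<^sub>2) - u(z\<^sub>1))\<^sup>2\<close>. Moving contractions to the right in
  \<open>2 T(z\<^sub>2) b(z\<^sub>1) v\<close> therefore gives
  \<open>2 / (u(z\<^sub>2) - u(z\<^sub>1))\<^sup>2 b\<^sub>2 v + R(z\<^sub>2)\<close> with
  \<open>R(z\<^sub>2) = (i\<^sub>2 i\<^sub>2 i\<^sub>1 + e\<^sub>1 i\<^sub>2 i\<^sub>2 + 2 e\<^sub>2 i\<^sub>2 i\<^sub>1 + e\<^sub>2 e\<^sub>2 i\<^sub>1 + 2 e\<^sub>2 e\<^sub>1 i\<^sub>2 + e\<^sub>2 e\<^sub>2 e\<^sub>1) v\<close>
  (lemma \<open>polydiff_T_hat_b_hat\<close>).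
  Clearly \<open>R(z\<^sub>1) = S(z\<^sub>1) v\<close>, and what remains after subtracting the singular terms is
  \<open>2 / (u(z\<^sub>2) - u(z\<^sub>1))\<^sup>2\<close> times the Taylor remainder \<open>b\<^sub>2 v - b\<^sub>1 v - (u(z\<^sub>2) - u(z\<^sub>1)) b'\<^sub>1 v\<close>,
  which tends to \<open>b''\<^sub>1 v\<close> (lemma \<open>has_polydiff_limit_taylor\<close>).

  For these limits one needs that \<open>b\<^sub>2 v\<close> and \<open>R(z\<^sub>2)\<close> are, in each degree, rational functions of
  the coordinates \<open>u\<close> of \<open>z\<^sub>2\<close> and of the auxiliary points, without a pole along \<open>z\<^sub>2 = z\<^sub>1\<close>. This
  rests on two facts of function theory, consequences of Liouville's theorem: a coordinate is a
  Moebius transformation (\<open>coordinate_moebius\<close>), and a meromorphic form is \<open>p(u)/q(u) du\<close> with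
  polynomials \<open>p\<close>, \<open>q\<close> without common roots (\<open>residueless_rational\<close>), so that \<open>q(u)\<close> vanishes
  only at its poles. Hence \<open>v\<close> is a
  polynomial in forms that are regular on a common cofinite set \<open>N\<close> containing \<open>z\<^sub>1\<close>, their contractions
  are rational without poles on \<open>N\<close> (\<open>regular_family_i_hat\<close>), and all the expressions above are sums
  of monomials in forms depending rationally on \<open>z\<^sub>2\<close>, whose polydifferentials are rational
  (\<open>ratfun_polydiff\<close>).
\<close>

section \<open>Meromorphic functions on the projective line are rational\<close>

lemma entire_polynomial:
  fixes f :: "complex \<Rightarrow> complex"
  assumes holo: "f holomorphic_on UNIV" and lim: "((\<lambda>t. f (1 / t) * t ^ n) \<longlongrightarrow> l) (at 0)"
  shows "\<exists>p. degree p \<le> n \<and> (\<forall>x. f x = poly p x)"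
proof -
  have "eventually (\<lambda>t. norm (f (1 / t) * t ^ n - l) < 1) (at 0)"
    using tendstoD[OF lim, of 1] by (simp add: dist_norm)
  then obtain d where d: "d > 0" "\<And>t. t \<noteq> 0 \<Longrightarrow> norm t < d \<Longrightarrow> norm (f (1 / t) * t ^ n - l) < 1"
    by (auto simp: eventually_at)
  have "norm (f z) \<le> (norm l + 1) * norm z ^ n" if z: "norm z \<ge> 2 / d" for z
  proof -
    have "norm z > 0" using z d(1) by (smt (verit) divide_pos_pos)
    then have z0: "z \<noteq> 0" by auto
    have "norm (1 / z) < d"
      using z d(1) \<open>norm z > 0\<close> by (simp add: norm_divide field_simps)
    then have "norm (f z * (1 / z) ^ n - l) < 1"
      using d(2)[of "1 / z"] z0 by simp
    then have "norm (f z * (1 / z) ^ n) \<le> norm l + 1"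
      using norm_triangle_ineq2[of "f z * (1 / z) ^ n" l] by linarith
    then show ?thesis
      using \<open>norm z > 0\<close> by (simp add: norm_mult norm_power norm_divide field_simps)
  qed
  then have "f x = (\<Sum>k\<le>n. (deriv ^^ k) f 0 / fact k * x ^ k)" for x
    by (rule Liouville_polynomial[OF holo])
  then have "f x = poly (\<Sum>k\<le>n. monom ((deriv ^^ k) f 0 / fact k) k) x" for x
    by (simp add: poly_sum poly_monom)
  moreover have "degree (\<Sum>k\<le>n. monom ((deriv ^^ k) f 0 / fact k) k) \<le> n"
    by (intro degree_sum_le) (auto intro: order.trans[OF degree_monom_le])
  ultimately show ?thesis by blast
qed

lemma poly_analytic_on: "poly (q :: complex poly) analytic_on A"
proof -
  have "poly q holomorphic_on UNIV"
    by (intro holomorphic_onI) (auto simp: field_differentiable_def intro: poly_DERIV)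
  then show ?thesis
    using analytic_on_open[of UNIV] analytic_on_subset by blast
qed

lemma laurent_power_limit:
  assumes "f has_laurent_expansion F"
  shows "\<exists>n l. ((\<lambda>t. f t * t ^ n) \<longlongrightarrow> l) (at 0)"
proof -
  define n where "n = nat (- fls_subdegree F)"
  have "(\<lambda>t. f t * t ^ n) has_laurent_expansion F * fls_X ^ n"
    by (intro laurent_expansion_intros assms)
  moreover have "fls_subdegree (F * fls_X ^ n) \<ge> 0"
    by (cases "F = 0") (auto simp: n_def fls_subdegree_mult fls_subdegree_pow)
  ultimately show ?thesis
    using has_laurent_expansion_imp_tendsto_0 by blast
qed

lemma meromorphic_on_sphere_rational:
  fixes g :: "complex \<Rightarrow> complex"
  assumes mer: "g meromorphic_on UNIV" and inf: "(\<lambda>t. g (1 / t)) meromorphic_on {0}"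
  shows "\<exists>p q. q \<noteq> 0 \<and> finite {x. g x \<noteq> poly p x / poly q x}"
proof -
  define S where "S = {x. \<not> g analytic_on {x}}"
  have "eventually (\<lambda>t. (\<lambda>t. g (1 / t)) analytic_on {t}) (at 0)"
    using meromorphic_on_imp_not_islimpt_singularities[OF inf, of 0]
    by (simp add: islimpt_iff_eventually)
  then obtain d where d: "d > 0" "\<And>t. t \<noteq> 0 \<Longrightarrow> norm t < d \<Longrightarrow> (\<lambda>t. g (1 / t)) analytic_on {t}"
    by (auto simp: eventually_at)
  have "S \<subseteq> cball 0 (1 / d)"
  proof
    fix x assume x: "x \<in> S"
    show "x \<in> cball 0 (1 / d)"
    proof (rule ccontr)
      assume "x \<notin> cball 0 (1 / d)"
      then have nx: "norm x > 1 / d" by (simp add: dist_norm)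
      then have "norm x > 0" using d(1) by (smt (verit) divide_pos_pos)
      then have x0: "x \<noteq> 0" "norm (1 / x) < d"
        using nx d(1) by (auto simp: norm_divide field_simps)
      then have "(\<lambda>t. g (1 / t)) analytic_on {1 / x}" using d(2)[of "1 / x"] by simp
      then have "((\<lambda>t. g (1 / t)) \<circ> (\<lambda>x. 1 / x)) analytic_on {x}"
        using x0 by (intro analytic_on_compose analytic_intros) auto
      then show False using x by (simp add: S_def o_def)
    qed
  qed
  moreover have "\<not> x islimpt S" for x
    using meromorphic_on_imp_not_islimpt_singularities[OF mer, of x] by (simp add: S_def)
  moreover have "bounded S"
    using calculation(1) bounded_cball bounded_subset by blast
  ultimately have S: "finite S"
    using bounded_infinite_imp_islimpt[of S S] by blast
  have "\<exists>n l. ((\<lambda>t. g (a + t) * t ^ n) \<longlongrightarrow> l) (at 0)" for a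
    using mer laurent_power_limit unfolding meromorphic_on_def by blast
  then obtain N l where Nl: "\<And>a. ((\<lambda>t. g (a + t) * t ^ N a) \<longlongrightarrow> l a) (at 0)" by metis
  \<comment> \<open>Clearing the poles in the finite plane leaves an entire function of polynomial growth.\<close>
  define q where "q = (\<Prod>a\<in>S. [:-a, 1:] ^ N a)"
  have q0: "q \<noteq> 0" using S by (auto simp: q_def)
  define h where "h x = g x * poly q x" for x
  have an: "h analytic_on {x}" if "x \<notin> S" for x
    unfolding h_def using that by (intro analytic_intros poly_analytic_on) (auto simp: S_def)
  have hlim: "\<exists>c. h \<midarrow>a\<rightarrow> c" for a
  proof (cases "a \<in> S")
    case False
    then show ?thesis using an analytic_at_imp_isCont isContD by blast
  next
    case True
    have "((\<lambda>t. (g (a + t) * t ^ N a) * (\<Prod>b\<in>S - {a}. (a + t - b) ^ N b)) \<longlongrightarrow>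
        l a * (\<Prod>b\<in>S - {a}. (a + 0 - b) ^ N b)) (at 0)"
      by (intro tendsto_intros Nl)
    moreover have "h (a + t) = (g (a + t) * t ^ N a) * (\<Prod>b\<in>S - {a}. (a + t - b) ^ N b)" for t
      using S True by (simp add: h_def q_def poly_prod prod.remove[of _ a] algebra_simps)
    ultimately have "((\<lambda>t. h (a + t)) \<longlongrightarrow> l a * (\<Prod>b\<in>S - {a}. (a + 0 - b) ^ N b)) (at 0)"
      by simp
    then show ?thesis using LIM_offset_zero_cancel by blast
  qed
  have hm: "h meromorphic_on UNIV"
    unfolding h_def by (intro meromorphic_intros mer analytic_on_imp_meromorphic_on poly_analytic_on)
  define H where "H = remove_sings h"
  have "H analytic_on {x}" for x
  proof -
    have "isolated_singularity_at h x" using meromorphic_on_subset[OF hm, of "{x}"] by (intro meromorphic_on_isolated_singularity) simp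
    then show ?thesis unfolding H_def using hlim[of x] remove_sings_analytic_at by blast
  qed
  then have Hol: "H holomorphic_on UNIV"
    by (metis analytic_imp_holomorphic analytic_on_analytic_at)
  have "eventually (\<lambda>t. H (1 / t) = h (1 / t)) (at 0)"
  proof -
    have "eventually (\<lambda>t. t \<notin> (\<lambda>x. 1 / x) ` S) (at (0::complex))"
      using S islimpt_finite islimpt_iff_eventually by (metis finite_imageI)
    then show ?thesis
    proof (rule eventually_mono)
      fix t assume "t \<notin> (\<lambda>x. 1 / x) ` S"
      moreover have "t = 1 / (1 / t)" by simp
      ultimately have "1 / t \<notin> S" by blast
      then show "H (1 / t) = h (1 / t)" unfolding H_def by (intro remove_sings_at_analytic an)
    qed
  qed
  moreover have "(\<lambda>t. h (1 / t)) meromorphic_on {0}"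
    unfolding h_def
    by (intro meromorphic_on_mult inf)
       (simp only: poly_altdef, intro meromorphic_intros)
  then obtain F where F: "(\<lambda>t. h (1 / t)) has_laurent_expansion F"
    by (auto simp: meromorphic_on_def)
  ultimately have "(\<lambda>t. H (1 / t)) has_laurent_expansion F"
    using has_laurent_expansion_cong[of "\<lambda>t. H (1 / t)" "\<lambda>t. h (1 / t)" F F] by simp
  then obtain n l where "((\<lambda>t. H (1 / t) * t ^ n) \<longlongrightarrow> l) (at 0)"
    using laurent_power_limit by blast
  then obtain p where p: "\<And>x. H x = poly p x"
    using entire_polynomial[OF Hol] by blast
  have "finite {x. poly q x = 0}" using q0 poly_roots_finite by blast
  moreover have "{x. g x \<noteq> poly p x / poly q x} \<subseteq> S \<union> {x. poly q x = 0}"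
  proof (intro subsetI, rule ccontr)
    fix x assume x: "x \<in> {x. g x \<noteq> poly p x / poly q x}" "x \<notin> S \<union> {x. poly q x = 0}"
    then have "poly p x = g x * poly q x"
      using an[of x] p[of x] by (simp add: H_def h_def)
    then show False using x by simp
  qed
  ultimately show ?thesis
    using S q0 finite_subset[of _ "S \<union> {x. poly q x = 0}"] by blast
qed

section \<open>Coordinates and forms in terms of a coordinate\<close>

text \<open>Multiplying \<open>u\<close> by \<open>x - p\<close> if its pole is at a finite point \<open>p\<close> gives an entire function that
  grows at most linearly, so a coordinate is a Moebius transformation. Its value at the pole
  remains unspecified.\<close>

lemma coordinate_moebius:
  assumes "is_coordinate u P"
  obtains a b where "P = Infty" "a \<noteq> 0" "\<And>x. u (Fin x) = a * x + b"
  | p c b where "P = Fin p" "c \<noteq> 0" "u Infty = b" "\<And>x. x \<noteq> p \<Longrightarrow> u (Fin x) = c / (x - p) + b"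
proof -
  define U where "U x = u (Fin x)" for x
  have Fin: "u \<circ> chart (Fin a) = (\<lambda>t. U (a + t))" for a
    by (auto simp: chart_def U_def)
  have analytic_U: "U analytic_on {a}" if "Fin a \<noteq> P" for a
  proof -
    have "(\<lambda>t. U (a + t)) analytic_on {0}"
      using assms that Fin unfolding is_coordinate_def by metis
    then have "((\<lambda>t. U (a + t)) \<circ> (\<lambda>x. x - a)) analytic_on {a}"
      by (intro analytic_on_compose analytic_intros) auto
    then show ?thesis by (simp add: o_def)
  qed
  have P: "is_pole (u \<circ> chart P) 0" "zorder (u \<circ> chart P) 0 = -1" "(u \<circ> chart P) meromorphic_on {0}"
    using assms by (auto simp: is_coordinate_def)
  obtain L where L: "(u \<circ> chart P) has_laurent_expansion L"
    using P(3) unfolding meromorphic_on_def by (simp del: o_apply) blast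
  have L0: "L \<noteq> 0"
    using P(1) L by (metis has_laurent_expansion_imp_is_pole_0 is_pole_0_imp_neg_fls_subdegree fls_zero_subdegree less_irrefl)
  have sub: "fls_subdegree L = -1"
    using has_laurent_expansion_zorder_0[OF L L0] P(2) by simp
  have "(\<lambda>t. (u \<circ> chart P) t * t) has_laurent_expansion L * fls_X"
    by (intro laurent_expansion_intros L)
  moreover have "fls_subdegree (L * fls_X) \<ge> 0" using sub L0 by (simp add: fls_subdegree_mult)
  ultimately obtain l where l: "((\<lambda>t. (u \<circ> chart P) t * t) \<longlongrightarrow> l) (at 0)"
    using has_laurent_expansion_imp_tendsto_0 by blast
  have linear: "\<exists>a b. \<forall>x. poly p x = a * x + b" if "degree p \<le> 1" for p :: "complex poly"
  proof -
    have "p = [:coeff p 0, coeff p 1:]"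
      using that by (intro poly_eqI) (auto simp: coeff_pCons coeff_eq_0 split: nat.splits)
    then have "poly p x = coeff p 1 * x + coeff p 0" for x
      by (metis poly_pCons poly_0 mult_zero_right add.right_neutral add.commute mult.commute)
    then show ?thesis by blast
  qed
  show thesis
  proof (cases P)
    case Infty
    have "U holomorphic_on UNIV"
      by (metis analytic_U Infty analytic_imp_holomorphic analytic_on_analytic_at cp1.distinct(1))
    moreover have "((\<lambda>t. U (1 / t) * t ^ 1) \<longlongrightarrow> l) (at 0)"
      by (rule Lim_transform_eventually[OF l])
         (auto simp: eventually_at_filter chart_def Infty U_def)
    ultimately obtain p where p: "degree p \<le> 1" "\<forall>x. U x = poly p x"
      using entire_polynomial by blast
    then obtain a b where ab: "\<And>x. U x = a * x + b" using linear by metis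
    have "a \<noteq> 0"
    proof
      assume "a = 0"
      then have "((u \<circ> chart P) \<longlongrightarrow> b) (at 0)"
        by (intro tendsto_eventually) (auto simp: eventually_at_filter chart_def Infty ab U_def[symmetric])
      then show False using P(1) not_tendsto_and_filterlim_at_infinity[OF at_neq_bot]
        unfolding is_pole_def by blast
    qed
    then show thesis using that(1)[OF Infty] ab by (auto simp: U_def)
  next
    case (Fin p)
    define K where "K = remove_sings (\<lambda>x. U x * (x - p))"
    have an: "(\<lambda>x. U x * (x - p)) analytic_on {x}" if "x \<noteq> p" for x
      by (intro analytic_intros analytic_U) (auto simp: Fin that)
    have lp: "(\<lambda>x. U x * (x - p)) \<midarrow>p\<rightarrow> l"
      by (rule LIM_offset_zero_cancel) (use l in \<open>simp add: Fin chart_def U_def o_def\<close>)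
    have "isolated_singularity_at (\<lambda>x. U x * (x - p)) p"
      unfolding isolated_singularity_at_def
      by (intro exI[of _ 1], subst analytic_on_analytic_at) (use an in auto)
    then have "K analytic_on {p}"
      unfolding K_def using lp by (rule remove_sings_analytic_at)
    moreover have "K analytic_on {x}" if "x \<noteq> p" for x
      unfolding K_def using an[OF that] by (rule remove_sings_analytic_on)
    ultimately have "K holomorphic_on UNIV"
      by (metis analytic_imp_holomorphic analytic_on_analytic_at)
    have KU: "K x = U x * (x - p)" if "x \<noteq> p" for x
      unfolding K_def using an[OF that] by simp
    have "(u \<circ> chart Infty) analytic_on {0}"
      using assms Fin by (simp add: is_coordinate_def)
    then have lim0: "(u \<circ> chart Infty) \<midarrow>0\<rightarrow> (u \<circ> chart Infty) 0"
      using analytic_at_imp_isCont isContD by blast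
    have chart0: "(u \<circ> chart Infty) 0 = u Infty" by (simp add: chart_def)
    have "((\<lambda>t. (u \<circ> chart Infty) t * (1 - p * t)) \<longlongrightarrow> u Infty * (1 - p * 0)) (at 0)"
      by (intro tendsto_mult lim0[unfolded chart0] tendsto_intros)
    then have "((\<lambda>t. (u \<circ> chart Infty) t * (1 - p * t)) \<longlongrightarrow> u Infty) (at 0)"
      by simp
    moreover have "eventually (\<lambda>t. (u \<circ> chart Infty) t * (1 - p * t) = K (1 / t) * t ^ 1) (at 0)"
    proof -
      have "eventually (\<lambda>t. t \<noteq> 1 / p) (at (0::complex))"
        by (cases "p = 0") (auto intro: eventually_neq_at_within simp: eventually_neq_at_within)
      then show ?thesis
        using eventually_neq_at_within[of 0]
      proof eventually_elim
        case (elim t)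
        then have "1 / t \<noteq> p" by auto
        then show ?case using elim by (simp add: KU chart_def U_def field_simps)
      qed
    qed
    ultimately have K1: "((\<lambda>t. K (1 / t) * t ^ 1) \<longlongrightarrow> u Infty) (at 0)"
      by (rule Lim_transform_eventually)
    obtain q where q: "degree q \<le> 1" "\<And>x. K x = poly q x"
      using entire_polynomial[OF \<open>K holomorphic_on UNIV\<close> K1] by blast
    then obtain a b where ab: "\<And>x. K x = a * x + b" using linear by metis
    have "((\<lambda>t. a + b * t) \<longlongrightarrow> a + b * 0) (at 0)" by (intro tendsto_intros)
    then have "((\<lambda>t. a + b * t) \<longlongrightarrow> a) (at 0)" by simp
    then have "((\<lambda>t. K (1 / t) * t ^ 1) \<longlongrightarrow> a) (at 0)"
      by (rule Lim_transform_eventually)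
         (auto simp: eventually_at_filter ab field_simps)
    then have ua: "u Infty = a" using K1 LIM_unique by blast
    have U: "U x = (a * p + b) / (x - p) + a" if "x \<noteq> p" for x
      using KU[OF that] ab[of x] that by (simp add: field_simps)
    have "a * p + b \<noteq> 0"
    proof
      assume "a * p + b = 0"
      then have "((u \<circ> chart P) \<longlongrightarrow> a) (at 0)"
        using U by (intro tendsto_eventually) (auto simp: eventually_at_filter chart_def Fin U_def)
      then show False using P(1) not_tendsto_and_filterlim_at_infinity[OF at_neq_bot]
        unfolding is_pole_def by blast
    qed
    then show thesis using that(2)[OF Fin] U ua by (auto simp: U_def)
  qed
qed

lemma coordinate_inj_on:
  assumes "is_coordinate u P" shows "inj_on u (- {P})"
  using coordinate_moebius[OF assms]
proof cases
  case (1 a b)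
  have *: "\<exists>x. z = Fin x" if "z \<noteq> P" for z using that 1(1) by (cases z) auto
  show ?thesis
  proof (rule inj_onI)
    fix y z assume "y \<in> - {P}" "z \<in> - {P}" "u y = u z"
    then show "y = z" using *[of y] *[of z] 1 by auto
  qed
next
  case (2 p c b)
  have *: "z = Infty \<or> (\<exists>x. z = Fin x \<and> x \<noteq> p)" if "z \<noteq> P" for z
    using that 2(1) by (cases z) auto
  show ?thesis
  proof (rule inj_onI)
    fix y z assume "y \<in> - {P}" "z \<in> - {P}" "u y = u z"
    then show "y = z" using *[of y] *[of z] 2(2,3) by (auto simp: 2(4))
  qed
qed

lemma moebius_deriv:
  assumes U: "\<And>x. x \<noteq> p \<Longrightarrow> u (Fin x) = c / (x - p) + b" and x: "x \<noteq> p"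
  shows "deriv (\<lambda>y. u (Fin y)) x = - c / (x - p) ^ 2"
proof (rule DERIV_imp_deriv)
  have "((\<lambda>y. c / (y - p) + b) has_field_derivative - c / (x - p) ^ 2) (at x)"
    using x by (auto intro!: derivative_eq_intros simp: power2_eq_square)
  then show "((\<lambda>y. u (Fin y)) has_field_derivative - c / (x - p) ^ 2) (at x)"
    by (rule has_field_derivative_transform_within_open[of _ _ _ "- {p}"]) (use x U in auto)
qed

lemma moebius_deriv_affine:
  assumes "\<And>x. u (Fin x) = a * x + b"
  shows "deriv (\<lambda>y. u (Fin y)) x = a"
  unfolding assms by (rule DERIV_imp_deriv) (auto intro!: derivative_eq_intros)

text \<open>In the local parameter \<open>t\<close> at \<open>z\<close>, the form \<open>G(u) du\<close> has the coefficient \<open>G(u(t)) u'(t)\<close>.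
  Here \<open>D\<close> is \<open>u'\<close>; it is the same for all \<open>G\<close>.\<close>

lemma coordinate_pullback:
  assumes "is_coordinate u P" "z \<noteq> P"
  shows "\<exists>D. isCont D 0 \<and> ((u \<circ> chart z) has_field_derivative D 0) (at 0) \<and> D 0 \<noteq> 0 \<and>
    (\<forall>G. eventually (\<lambda>t. form_coeff (\<lambda>x. G (u (Fin x)) * deriv (\<lambda>y. u (Fin y)) x) z t =
       G (u (chart z t)) * D t) (at 0))"
  using coordinate_moebius[OF assms(1)]
proof cases
  case (1 a b)
  then obtain x0 where z: "z = Fin x0" using assms(2) by (cases z) auto
  note moebius_deriv_affine[OF 1(3), simp]
  have "((u \<circ> chart z) has_field_derivative a) (at 0)"
    by (auto simp: z o_def chart_def 1(3) intro!: derivative_eq_intros)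
  then show ?thesis
    using 1(2) by (intro exI[of _ "\<lambda>_. a"]) (auto simp: z form_coeff_def chart_def)
next
  case (2 p c b)
  have U': "deriv (\<lambda>y. u (Fin y)) x = - c / (x - p) ^ 2" if "x \<noteq> p" for x
    using moebius_deriv[of p u c b] 2(4) that by blast
  show ?thesis
  proof (cases z)
    case (Fin x0)
    have x0: "x0 \<noteq> p" using Fin assms(2) 2(1) by auto
    define D where "D t = - c / (x0 + t - p) ^ 2" for t
    have "((\<lambda>t. c / (x0 + t - p) + b) has_field_derivative D 0) (at 0)"
      using x0 by (auto intro!: derivative_eq_intros simp: power2_eq_square D_def)
    then have 1: "((u \<circ> chart z) has_field_derivative D 0) (at 0)"
      by (rule has_field_derivative_transform_within_open[of _ _ _ "- {p - x0}"])
         (use x0 in \<open>auto simp: Fin chart_def 2(4) algebra_simps\<close>)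
    have "eventually (\<lambda>t. x0 + t \<noteq> p) (at 0)"
      using eventually_neq_at_within[of "p - x0" 0 UNIV] by eventually_elim auto
    then have "eventually (\<lambda>t. form_coeff (\<lambda>x. G (u (Fin x)) * deriv (\<lambda>y. u (Fin y)) x) z t =
       G (u (chart z t)) * D t) (at 0)" for G
      by eventually_elim (simp add: form_coeff_def Fin chart_def U' D_def)
    moreover have "isCont D 0" unfolding D_def using x0 by (intro continuous_intros) auto
    moreover have "D 0 \<noteq> 0" using x0 2(2) by (simp add: D_def)
    ultimately show ?thesis using 1 by blast
  next
    case Infty
    define D where "D t = c / (1 - p * t) ^ 2" for t
    have "((\<lambda>t. c * t / (1 - p * t) + b) has_field_derivative D 0) (at 0)"
      by (auto intro!: derivative_eq_intros simp: power2_eq_square D_def)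
    then have 1: "((u \<circ> chart z) has_field_derivative D 0) (at 0)"
    proof (rule has_field_derivative_transform_within_open[of _ _ _ "- {t. 1 - p * t = 0}"])
      show "open (- {t. 1 - p * t = 0})"
        by (intro open_Compl closed_Collect_eq continuous_intros)
      fix t assume t: "t \<in> - {t. 1 - p * t = 0}"
      then have "t \<noteq> 0 \<Longrightarrow> 1 / t \<noteq> p" by (auto simp: field_simps)
      then show "c * t / (1 - p * t) + b = (u \<circ> chart z) t"
        using t by (auto simp: Infty chart_def 2(3,4) divide_simps)
    qed auto
    have "eventually (\<lambda>t. t \<noteq> inverse p) (at 0)"
      by (rule eventually_neq_at_within)
    moreover have "eventually (\<lambda>t::complex. t \<noteq> 0) (at 0)"
      by (rule eventually_neq_at_within)
    ultimately have "eventually (\<lambda>t. form_coeff (\<lambda>x. G (u (Fin x)) * deriv (\<lambda>y. u (Fin y)) x) z t =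
       G (u (chart z t)) * D t) (at 0)" for G
    proof eventually_elim
      case (elim t)
      then have "1 / t \<noteq> p" by (metis inverse_eq_divide inverse_inverse_eq)
      moreover from this have "1 - p * t \<noteq> 0" using elim by (auto simp: field_simps)
      moreover from this have "1 / t - p = (1 - p * t) / t" using elim by (simp add: diff_divide_distrib)
      ultimately show ?case
        using elim by (simp add: form_coeff_def Infty chart_def U' D_def power_divide)
    qed
    moreover have "isCont D 0" unfolding D_def by (intro continuous_intros) auto
    moreover have "D 0 \<noteq> 0" using 2(2) by (simp add: D_def)
    ultimately show ?thesis using 1 by blast
  qed
qed

lemma form_coeff_eventually_cong:
  assumes "finite {x. f x \<noteq> g x}"
  shows "eventually (\<lambda>t. form_coeff f p t = form_coeff g p t) (at 0)"
proof -
  define S where "S = (\<lambda>x. case p of Fin a \<Rightarrow> x - a | Infty \<Rightarrow> 1 / x) ` {x. f x \<noteq> g x}"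
  have "finite S" using assms by (auto simp: S_def)
  then have "eventually (\<lambda>t. t \<notin> S) (at 0)"
    using islimpt_finite islimpt_iff_eventually by metis
  then show ?thesis
    by (rule eventually_mono) (cases p; force simp: S_def form_coeff_def image_iff)
qed

text \<open>The form \<open>g dx\<close> is \<open>p(u)/q(u) du\<close>. Finitely many points are disregarded, as in the equality
  of forms.\<close>

definition form_quotient ::
  "(cp1 \<Rightarrow> complex) \<Rightarrow> (complex \<Rightarrow> complex) \<Rightarrow> complex poly \<Rightarrow> complex poly \<Rightarrow> bool" where
  "form_quotient u g p q \<longleftrightarrow>
     finite {x. g x \<noteq> poly p (u (Fin x)) / poly q (u (Fin x)) * deriv (\<lambda>y. u (Fin y)) x}"

lemma form_coeff_rational:
  assumes u: "is_coordinate u P" "z \<noteq> P" and g: "form_quotient u g p q"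
  obtains D where "D \<midarrow>0\<rightarrow> deriv (u \<circ> chart z) 0" "deriv (u \<circ> chart z) 0 \<noteq> 0"
    "(\<lambda>t. u (chart z t)) \<midarrow>0\<rightarrow> u z"
    "eventually (\<lambda>t. form_coeff g z t = poly p (u (chart z t)) / poly q (u (chart z t)) * D t) (at 0)"
proof -
  obtain D where D: "isCont D 0" "((u \<circ> chart z) has_field_derivative D 0) (at 0)" "D 0 \<noteq> 0"
    "\<And>G. eventually (\<lambda>t. form_coeff (\<lambda>x. G (u (Fin x)) * deriv (\<lambda>y. u (Fin y)) x) z t =
       G (u (chart z t)) * D t) (at 0)"
    using coordinate_pullback[OF u] by blast
  have d: "deriv (u \<circ> chart z) 0 = D 0" using D(2) DERIV_imp_deriv by blast
  have "isCont (u \<circ> chart z) 0" using D(2) DERIV_isCont by blast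
  moreover have "chart z 0 = z" by (cases z) (auto simp: chart_def)
  ultimately have "(\<lambda>t. u (chart z t)) \<midarrow>0\<rightarrow> u z" by (simp add: isCont_def o_def)
  moreover have "eventually (\<lambda>t. form_coeff g z t =
      poly p (u (chart z t)) / poly q (u (chart z t)) * D t) (at 0)"
    using form_coeff_eventually_cong[OF g[unfolded form_quotient_def], of z] D(4)[of "\<lambda>y. poly p y / poly q y"]
    by eventually_elim simp
  ultimately show thesis
    using that[of D] D(1,3) d by (simp add: isCont_def)
qed

lemma form_val_rational:
  assumes u: "is_coordinate u P" "z \<noteq> P" and g0: "residueless g"
    and g: "form_quotient u g p q"
    and q: "poly q (u z) \<noteq> 0"
  shows "regular_at z (abs_kform g)" "form_val u z (abs_kform g) = poly p (u z) / poly q (u z)"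
proof -
  obtain D where D: "D \<midarrow>0\<rightarrow> deriv (u \<circ> chart z) 0" "deriv (u \<circ> chart z) 0 \<noteq> 0"
    "(\<lambda>t. u (chart z t)) \<midarrow>0\<rightarrow> u z"
    "eventually (\<lambda>t. form_coeff g z t = poly p (u (chart z t)) / poly q (u (chart z t)) * D t) (at 0)"
    by (rule form_coeff_rational[OF u g])
  have "(\<lambda>t. poly p (u (chart z t)) / poly q (u (chart z t)) * D t) \<midarrow>0\<rightarrow>
      poly p (u z) / poly q (u z) * deriv (u \<circ> chart z) 0"
    by (intro tendsto_intros D(1,3) q)
  then have lim: "form_coeff g z \<midarrow>0\<rightarrow> poly p (u z) / poly q (u z) * deriv (u \<circ> chart z) 0"
    by (rule Lim_transform_eventually) (use D(4) in \<open>eventually_elim, simp\<close>)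
  have rel: "form_rel g g" using g0 by (simp add: form_rel_def)
  have "\<not> is_pole (form_coeff g z) 0"
    using lim not_tendsto_and_filterlim_at_infinity[OF at_neq_bot] unfolding is_pole_def by blast
  then show "regular_at z (abs_kform g)"
    using regular_at.abs_eq[OF rel] by simp
  show "form_val u z (abs_kform g) = poly p (u z) / poly q (u z)"
    unfolding form_val_def const_coeff_regular[OF g0 lim] using D(2) by simp
qed

lemma chart_eventually_neq: "eventually (\<lambda>t. chart z t \<noteq> w) (at 0)"
proof -
  have "eventually (\<lambda>t. t \<noteq> (case (z, w) of (Fin a, Fin b) \<Rightarrow> b - a | (Infty, Fin b) \<Rightarrow> inverse b | _ \<Rightarrow> 0)) (at 0)"
    by (rule eventually_neq_at_within)
  moreover have "eventually (\<lambda>t::complex. t \<noteq> 0) (at 0)" by (rule eventually_neq_at_within)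
  ultimately show ?thesis
    by eventually_elim (auto simp: chart_def inverse_eq_divide split: cp1.splits)
qed

lemma chart_eventually_notin_finite: "finite S \<Longrightarrow> eventually (\<lambda>t. chart z t \<notin> S) (at 0)"
  by (rule eventually_mono[OF eventually_ball_finite[of S "\<lambda>t w. chart z t \<noteq> w"]])
     (auto simp: chart_eventually_neq)

lemma finite_coordinate_roots:
  assumes "is_coordinate u P" "q \<noteq> 0"
  shows "finite {z. z \<noteq> P \<and> poly q (u z) = 0}"
proof (rule finite_imageD)
  show "finite (u ` {z. z \<noteq> P \<and> poly q (u z) = 0})"
    by (rule finite_subset[OF _ poly_roots_finite[OF assms(2)]]) auto
  show "inj_on u {z. z \<noteq> P \<and> poly q (u z) = 0}"
    by (rule inj_on_subset[OF coordinate_inj_on[OF assms(1)]]) auto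
qed

text \<open>A root of \<open>q\<close> that is not a root of \<open>p\<close> is a pole of \<open>p(u)/q(u) du\<close>, because \<open>du\<close> has no zero
  away from the pole of \<open>u\<close>.\<close>

lemma regular_at_denominator:
  assumes u: "is_coordinate u P" "z \<noteq> P" and g0: "residueless g"
    and g: "form_quotient u g p q"
    and q: "q \<noteq> 0" "poly q (u z) = 0 \<Longrightarrow> poly p (u z) \<noteq> 0" and reg: "regular_at z (abs_kform g)"
  shows "poly q (u z) \<noteq> 0"
proof
  assume 0: "poly q (u z) = 0"
  note p0 = q(2)[OF 0]
  obtain D where D: "D \<midarrow>0\<rightarrow> deriv (u \<circ> chart z) 0" "deriv (u \<circ> chart z) 0 \<noteq> 0"
    "(\<lambda>t. u (chart z t)) \<midarrow>0\<rightarrow> u z"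
    "eventually (\<lambda>t. form_coeff g z t = poly p (u (chart z t)) / poly q (u (chart z t)) * D t) (at 0)"
    by (rule form_coeff_rational[OF u g])
  have num: "(\<lambda>t. poly p (u (chart z t)) * D t) \<midarrow>0\<rightarrow> poly p (u z) * deriv (u \<circ> chart z) 0"
    by (intro tendsto_intros D(1,3))
  have "(\<lambda>t. poly q (u (chart z t))) \<midarrow>0\<rightarrow> poly q (u z)"
    by (intro tendsto_intros D(3))
  moreover have "eventually (\<lambda>t. poly q (u (chart z t)) \<noteq> 0) (at 0)"
    using chart_eventually_notin_finite[OF finite_coordinate_roots[OF u(1) q(1)], of z]
      chart_eventually_neq[of z P] by eventually_elim auto
  ultimately have "filterlim (\<lambda>t. poly q (u (chart z t))) (at 0) (at 0)"
    by (simp add: 0 filterlim_at)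
  then have "filterlim (\<lambda>t. poly p (u (chart z t)) * D t / poly q (u (chart z t))) at_infinity (at 0)"
    by (rule filterlim_divide_at_infinity[OF num]) (use p0 D(2) in simp)
  then have "filterlim (form_coeff g z) at_infinity (at 0)"
    by (rule filterlim_mono_eventually) (use D(4) in \<open>auto elim: eventually_mono\<close>)
  then have "is_pole (form_coeff g z) 0" by (simp add: is_pole_def)
  moreover have "form_rel g g" using g0 by (simp add: form_rel_def)
  ultimately show False using reg regular_at.abs_eq[of g z] by simp
qed

lemma form_quotient_reduce:
  assumes u: "is_coordinate u P" and "q \<noteq> 0" "form_quotient u g p q"
  shows "\<exists>p q. q \<noteq> 0 \<and> form_quotient u g p q \<and> (\<forall>y. poly q y = 0 \<longrightarrow> poly p y \<noteq> 0)"
  using assms(2,3)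
proof (induction "degree q" arbitrary: p q rule: less_induct)
  case less
  show ?case
  proof (cases "\<exists>y. poly q y = 0 \<and> poly p y = 0")
    case True
    then obtain y where "poly q y = 0" "poly p y = 0" by blast
    then obtain p' q' where pq: "p = [:- y, 1:] * p'" "q = [:- y, 1:] * q'"
      unfolding poly_eq_0_iff_dvd by (metis dvdE)
    have pq': "poly p x = (x - y) * poly p' x" "poly q x = (x - y) * poly q' x" for x
      by (simp_all add: pq algebra_simps)
    have q': "q' \<noteq> 0" using less.prems(1) pq(2) by auto
    have deg: "degree q' < degree q"
      unfolding pq(2) using q' by (subst degree_mult_eq) auto
    have "finite (Fin -` {z. z \<noteq> P \<and> poly [:- y, 1:] (u z) = 0} \<union> Fin -` {P})"
      by (intro finite_UnI finite_vimageI finite_coordinate_roots[OF u]) (auto intro: injI)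
    then have "finite ({x. g x \<noteq> poly p (u (Fin x)) / poly q (u (Fin x)) * deriv (\<lambda>y. u (Fin y)) x} \<union>
        (Fin -` {z. z \<noteq> P \<and> poly [:- y, 1:] (u z) = 0} \<union> Fin -` {P}))"
      using less.prems(2) by (simp only: form_quotient_def finite_Un)
    then have "form_quotient u g p' q'"
      unfolding form_quotient_def by (rule finite_subset[rotated]) (auto simp: pq')
    then show ?thesis using less.hyps[OF deg q'] by blast
  qed (use less.prems in blast)
qed

text \<open>The coefficient \<open>g\<close> is a rational function of \<open>x\<close>, and \<open>x\<close> is a Moebius transformation of \<open>u\<close>.\<close>

lemma residueless_rational:
  assumes u: "is_coordinate u P" and g: "residueless g"
  shows "\<exists>p q. q \<noteq> 0 \<and> form_quotient u g p q \<and> (\<forall>y. poly q y = 0 \<longrightarrow> poly p y \<noteq> 0)"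
proof -
  have mer: "form_coeff g p meromorphic_on {0}" for p
    using g by (simp add: residueless_def)
  have "g meromorphic_on UNIV"
    using mer[of "Fin a" for a] by (auto simp: meromorphic_on_def form_coeff_def)
  moreover have "(\<lambda>t. - (form_coeff g Infty t * t ^ 2)) meromorphic_on {0}"
    by (intro meromorphic_intros mer)
  then have "(\<lambda>t. g (1 / t)) meromorphic_on {0}"
    by (subst (asm) meromorphic_on_cong[OF _ refl, where g = "\<lambda>t. g (1 / t)"])
       (auto simp: eventually_at_filter form_coeff_def)
  ultimately obtain p1 q1 where q1: "q1 \<noteq> 0" and gfin: "finite {x. g x \<noteq> poly p1 x / poly q1 x}"
    using meromorphic_on_sphere_rational by blast
  have "\<exists>p q. q \<noteq> 0 \<and> form_quotient u g p q"
    using coordinate_moebius[OF u]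
  proof cases
    case (1 a b)
    note U' = moebius_deriv_affine[OF 1(3)]
    define r where "r = [:- b / a, 1 / a:]"
    have r: "poly r (u (Fin x)) = x" for x using 1 by (simp add: r_def field_simps)
    have "smult a (pcompose q1 r) \<noteq> 0"
      using \<open>a \<noteq> 0\<close> \<open>q1 \<noteq> 0\<close> pcompose_eq_0[of q1 r] by (auto simp: r_def)
    moreover have "form_quotient u g (pcompose p1 r) (smult a (pcompose q1 r))"
      using \<open>a \<noteq> 0\<close> gfin by (simp add: form_quotient_def poly_pcompose r U')
    ultimately show ?thesis by blast
  next
    case (2 p c b)
    have U': "deriv (\<lambda>y. u (Fin y)) x = - c / (x - p) ^ 2" if "x \<noteq> p" for x
    using moebius_deriv[of p u c b] 2(4) that by blast
    \<comment> \<open>Since \<open>x = p + c / (u - b)\<close>, a polynomial in \<open>x\<close> becomes one in \<open>u\<close> after multiplication by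
      a power of \<open>u - b\<close>.\<close>
    have hom: "\<exists>n s. \<forall>x. x \<noteq> p \<longrightarrow> poly f x * (u (Fin x) - b) ^ n = poly s (u (Fin x))" for f
    proof (induction f)
      case 0
      show ?case by (intro exI[of _ 0] exI[of _ 0]) simp
    next
      case (pCons a f)
      then obtain n s where s: "\<forall>x. x \<noteq> p \<longrightarrow> poly f x * (u (Fin x) - b) ^ n = poly s (u (Fin x))"
        by blast
      show ?case
      proof (intro exI[of _ "Suc n"] exI[of _ "[:a:] * [:-b, 1:] ^ Suc n + [:c - p * b, p:] * s"] allI impI)
        fix x assume x: "x \<noteq> p"
        have "x * (u (Fin x) - b) = p * u (Fin x) + (c - p * b)" using x 2(4)[OF x] by (simp add: field_simps)
        moreover have "poly (pCons a f) x * (u (Fin x) - b) ^ Suc n =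
           a * (u (Fin x) - b) ^ Suc n + (x * (u (Fin x) - b)) * (poly f x * (u (Fin x) - b) ^ n)"
          by (simp add: algebra_simps)
        ultimately have "poly (pCons a f) x * (u (Fin x) - b) ^ Suc n =
           a * (u (Fin x) - b) ^ Suc n + (p * u (Fin x) + (c - p * b)) * poly s (u (Fin x))"
          using s x by simp
        then show "poly (pCons a f) x * (u (Fin x) - b) ^ Suc n =
            poly ([:a:] * [:-b, 1:] ^ Suc n + [:c - p * b, p:] * s) (u (Fin x))"
          by (simp add: algebra_simps)
      qed
    qed
    obtain n s where s: "\<And>x. x \<noteq> p \<Longrightarrow> poly p1 x * (u (Fin x) - b) ^ n = poly s (u (Fin x))"
      using hom by metis
    obtain m r where r: "\<And>x. x \<noteq> p \<Longrightarrow> poly q1 x * (u (Fin x) - b) ^ m = poly r (u (Fin x))"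
      using hom by metis
    have ub: "u (Fin x) - b \<noteq> 0" if "x \<noteq> p" for x using 2(2) 2(4)[OF that] that by simp
    have "r \<noteq> 0"
    proof
      assume "r = 0"
      then have "poly q1 x = 0" if "x \<noteq> p" for x using r[OF that] ub[OF that] by simp
      then have "- {p} \<subseteq> {x. poly q1 x = 0}" by auto
      then have "finite (- {p})" using poly_roots_finite[OF \<open>q1 \<noteq> 0\<close>] finite_subset by blast
      then show False by (simp add: Compl_eq_Diff_UNIV infinite_UNIV_char_0)
    qed
    define P2 Q2 where "P2 = smult (- c) (s * [:-b, 1:] ^ m)" and "Q2 = r * [:-b, 1:] ^ n * [:-b, 1:] ^ 2"
    have "Q2 \<noteq> 0" using \<open>r \<noteq> 0\<close> by (simp add: Q2_def)
    have "poly p1 x / poly q1 x = poly P2 (u (Fin x)) / poly Q2 (u (Fin x)) * deriv (\<lambda>y. u (Fin y)) x"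
      if x: "x \<noteq> p" for x
    proof -
      define w where "w = u (Fin x) - b"
      have w: "w \<noteq> 0" "x - p = c / w" using ub[OF x] 2(4)[OF x] 2(2) x by (auto simp: w_def)
      have "poly p1 x = poly s (u (Fin x)) / w ^ n" "poly q1 x = poly r (u (Fin x)) / w ^ m"
        using s[OF x] r[OF x] w(1) by (auto simp: w_def[symmetric] field_simps)
      moreover have "deriv (\<lambda>y. u (Fin y)) x = - (w ^ 2 / c)"
        using U'[OF x] 2(2) w by (simp add: power2_eq_square)
      moreover have "poly P2 (u (Fin x)) = - c * (poly s (u (Fin x)) * w ^ m)"
        "poly Q2 (u (Fin x)) = poly r (u (Fin x)) * w ^ n * w ^ 2"
        by (simp_all add: P2_def Q2_def w_def)
      ultimately show ?thesis
        using w(1) 2(2) by simp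
    qed
    then have "{x. g x \<noteq> poly P2 (u (Fin x)) / poly Q2 (u (Fin x)) * deriv (\<lambda>y. u (Fin y)) x}
        \<subseteq> insert p {x. g x \<noteq> poly p1 x / poly q1 x}" by auto
    then have "form_quotient u g P2 Q2"
      unfolding form_quotient_def using finite_subset[OF _ finite.insertI[OF gfin]] by blast
    then show ?thesis using \<open>Q2 \<noteq> 0\<close> by blast
  qed
  then show ?thesis using form_quotient_reduce[OF u] by blast
qed

section \<open>Contraction and evaluation on the symmetric algebra\<close>

lemma of_scalar_0: "of_scalar 0 = 0"
  by (simp add: of_scalar.abs_eq zero_symK_def)

lemma of_scalar_add: "of_scalar (a + b) = of_scalar a + of_scalar b"
  by (simp add: of_scalar.abs_eq plus_symK.abs_eq single_add)

lemma polydiff_add: "polydiff u (v + w) xs = polydiff u v xs + polydiff u w xs"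
  by transfer (simp add: free_polydiff_simps)

lemma polydiff_monomial:
  "polydiff u (of_scalar c * (\<Prod>\<alpha>\<in>#M. of_form \<alpha>)) xs = c * form_perm u M xs / fact (length xs)"
proof -
  have "(\<Prod>\<alpha>\<in>#M. of_form \<alpha>) = abs_symK (Poly_Mapping.single M 1)"
  proof (induction M)
    case empty
    show ?case by (simp add: one_symK_def)
  next
    case (add \<alpha> M)
    then show ?case by (simp add: of_form.abs_eq times_symK.abs_eq mult_single)
  qed
  then have "of_scalar c * (\<Prod>\<alpha>\<in>#M. of_form \<alpha>) = abs_symK (Poly_Mapping.single M c)"
    by (simp add: of_scalar.abs_eq times_symK.abs_eq mult_single)
  then show ?thesis by (simp add: polydiff.abs_eq free_polydiff_simps)
qed

lemma polydiff_scale: "polydiff u (of_scalar c * v) xs = c * polydiff u v xs"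
proof (transfer fixing: c)
  fix u :: "cp1 \<Rightarrow> complex" and v xs
  show "free_polydiff u (cst c * v) xs = c * free_polydiff u v xs"
    by (induction v rule: free_alg_induct)
       (simp_all add: free_polydiff_simps mult_single algebra_simps)
qed

lemma i_hat_contraction: "is_contraction u z (i_hat u z)"
  unfolding i_hat_def using theI'[OF contraction_ex1] by blast

lemma i_hat_simps:
  assumes "v \<in> Wreg z" "w \<in> Wreg z"
  shows "i_hat u z v \<in> Wreg z"
    and "i_hat u z (v + w) = i_hat u z v + i_hat u z w"
    and "i_hat u z (v * w) = i_hat u z v * w + v * i_hat u z w"
    and "i_hat u z (of_scalar c * v) = of_scalar c * i_hat u z v"
  using i_hat_contraction[of u z] assms unfolding is_contraction_def by blast+

lemma i_hat_of_scalar: "i_hat u z (of_scalar c) = 0"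
  using i_hat_simps(4)[OF one_Wreg one_Wreg, of u z c] i_hat_contraction[of u z]
  by (simp add: is_contraction_def)

lemma i_hat_of_form: "regular_at z \<alpha> \<Longrightarrow> i_hat u z (of_form \<alpha>) = of_scalar (- form_val u z \<alpha>)"
  using i_hat_contraction[of u z] by (simp add: is_contraction_def)

text \<open>Away from \<open>P\<close> and the roots of \<open>q(u)\<close>, the form \<open>\<alpha>\<close> is regular and equals \<open>p(u)/q(u) du\<close>.
  In contrast to \<open>form_quotient\<close> there are no further exceptional points.\<close>

definition rational_form ::
  "(cp1 \<Rightarrow> complex) \<Rightarrow> cp1 \<Rightarrow> kform \<Rightarrow> complex poly \<Rightarrow> complex poly \<Rightarrow> bool" where
  "rational_form u P \<alpha> p q \<longleftrightarrow>
     (\<forall>z. z \<noteq> P \<longrightarrow> poly q (u z) \<noteq> 0 \<longrightarrow>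
        regular_at z \<alpha> \<and> form_val u z \<alpha> = poly p (u z) / poly q (u z))"

text \<open>The quotient is chosen without common roots, so that \<open>q\<close> vanishes only at poles of \<open>\<alpha>\<close>.\<close>

lemma regular_form_rational:
  assumes "is_coordinate u P" "z \<noteq> P" "regular_at z \<alpha>"
  shows "\<exists>p q. poly q (u z) \<noteq> 0 \<and> rational_form u P \<alpha> p q"
proof -
  define g where "g = rep_kform \<alpha>"
  have \<alpha>: "\<alpha> = abs_kform g" and g: "residueless g"
    using Quotient3_abs_rep[OF Quotient3_kform, of \<alpha>] Quotient3_rep_reflp[OF Quotient3_kform, of \<alpha>]
    by (simp_all add: g_def form_rel_def)
  obtain p q where "q \<noteq> 0" "form_quotient u g p q" "\<forall>y. poly q y = 0 \<longrightarrow> poly p y \<noteq> 0"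
    using residueless_rational[OF assms(1) g] by blast
  then show ?thesis
    using regular_at_denominator[OF assms(1,2) g, of p q] form_val_rational[OF assms(1) _ g, of _ p q] assms(3)
    unfolding \<alpha> rational_form_def by blast
qed

lemma rational_form_e_form:
  assumes "is_coordinate u P"
  shows "rational_form u P (e_form u z) [:-1:] ([:- u z, 1:] ^ 2)"
proof -
  let ?g = "\<lambda>x. - deriv (\<lambda>y. u (Fin y)) x / (u (Fin x) - u z) ^ 2"
  have "form_quotient u ?g [:-1:] ([:- u z, 1:] ^ 2)"
    by (simp add: form_quotient_def)
  then show ?thesis
    unfolding rational_form_def e_form_def
    using form_val_rational[OF assms _ residueless_e_form[OF assms]] by blast
qed

section \<open>Families of elements of the symmetric algebra\<close>

text \<open>On \<open>N\<close>, the function is a rational function of \<open>u\<close> without poles.\<close>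

definition rational_on :: "(cp1 \<Rightarrow> complex) \<Rightarrow> cp1 set \<Rightarrow> (cp1 \<Rightarrow> complex) \<Rightarrow> bool" where
  "rational_on u N r \<longleftrightarrow> (\<exists>p q. \<forall>z\<in>N. poly q (u z) \<noteq> 0 \<and> r z = poly p (u z) / poly q (u z))"

lemma rational_on_const: "rational_on u N (\<lambda>z. c)"
  unfolding rational_on_def by (intro exI[of _ "[:c:]"] exI[of _ 1]) simp

lemma rational_on_mult:
  assumes "rational_on u N r" "rational_on u N s"
  shows "rational_on u N (\<lambda>z. r z * s z)"
proof -
  obtain p q p' q' where "\<forall>z\<in>N. poly q (u z) \<noteq> 0 \<and> r z = poly p (u z) / poly q (u z)"
    "\<forall>z\<in>N. poly q' (u z) \<noteq> 0 \<and> s z = poly p' (u z) / poly q' (u z)"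
    using assms unfolding rational_on_def by blast
  then show ?thesis
    unfolding rational_on_def by (intro exI[of _ "p * p'"] exI[of _ "q * q'"]) simp
qed

lemma rational_on_subset: "rational_on u N r \<Longrightarrow> N' \<subseteq> N \<Longrightarrow> rational_on u N' r"
  unfolding rational_on_def by blast

text \<open>Families, rational over \<open>N\<close>, of elements that lie in \<open>Wreg z'\<close> for all \<open>z'\<close> in \<open>N\<close>: the
  algebra that is generated by the forms regular on \<open>N\<close> over the rational functions without poles
  on \<open>N\<close>. Values outside \<open>N\<close> are irrelevant by the last rule, which is needed because \<open>i_hat u z\<close>
  is a derivation only on \<open>Wreg z\<close>.\<close>

inductive_set regular_family ::
  "(cp1 \<Rightarrow> complex) \<Rightarrow> cp1 \<Rightarrow> cp1 set \<Rightarrow> (cp1 \<Rightarrow> symK) set" for u P N where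
  scalar: "rational_on u N r \<Longrightarrow> (\<lambda>z. of_scalar (r z)) \<in> regular_family u P N"
| form: "rational_form u P \<alpha> p q \<Longrightarrow> \<forall>z\<in>N. poly q (u z) \<noteq> 0 \<Longrightarrow> (\<lambda>z. of_form \<alpha>) \<in> regular_family u P N"
| add: "V \<in> regular_family u P N \<Longrightarrow> W \<in> regular_family u P N \<Longrightarrow> (\<lambda>z. V z + W z) \<in> regular_family u P N"
| mult: "V \<in> regular_family u P N \<Longrightarrow> W \<in> regular_family u P N \<Longrightarrow> (\<lambda>z. V z * W z) \<in> regular_family u P N"
| cong: "V \<in> regular_family u P N \<Longrightarrow> \<forall>z\<in>N. W z = V z \<Longrightarrow> W \<in> regular_family u P N"

lemma regular_family_antimono:
  assumes "V \<in> regular_family u P N" "N' \<subseteq> N" shows "V \<in> regular_family u P N'"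
  using assms
proof (induction rule: regular_family.induct)
  case (scalar r)
  then show ?case by (intro regular_family.scalar) (rule rational_on_subset)
next
  case (form \<alpha> p q)
  then show ?case using regular_family.form[of u P \<alpha> p q N'] by blast
next
  case (cong V W)
  then show ?case using regular_family.cong[of V u P N' W] by blast
qed (auto intro: regular_family.add regular_family.mult)

lemma regular_family_const:
  assumes "V \<in> regular_family u P N" "z0 \<in> N" shows "(\<lambda>z. V z0) \<in> regular_family u P N"
  using assms
proof (induction rule: regular_family.induct)
  case (scalar r)
  then show ?case by (intro regular_family.scalar rational_on_const)
next
  case (form \<alpha> p q)
  then show ?case by (rule_tac regular_family.form)
next
  case (cong V W)
  then show ?case by auto
qed (auto intro: regular_family.add regular_family.mult)

lemma regular_family_Wreg:
  assumes "V \<in> regular_family u P N" "P \<notin> N" "z \<in> N" "z' \<in> N" shows "V z \<in> Wreg z'"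
  using assms
proof (induction rule: regular_family.induct)
  case (form \<alpha> p q)
  then have "regular_at z' \<alpha>" unfolding rational_form_def by metis
  then show ?case by (rule Wreg.form)
qed (auto intro: Wreg.intros)

text \<open>This is why the class of families is introduced: iterated contractions, at the same or at
  different points, stay in it.\<close>

lemma regular_family_i_hat:
  assumes "V \<in> regular_family u P N" "P \<notin> N"
  shows "(\<lambda>z. i_hat u z (V z)) \<in> regular_family u P N"
  using assms
proof (induction rule: regular_family.induct)
  case (scalar r)
  show ?case
    using regular_family.scalar[OF rational_on_const[of u N 0], of P]
    by (simp add: i_hat_of_scalar of_scalar_0)
next
  case (form \<alpha> p q)
  have val: "regular_at z \<alpha> \<and> form_val u z \<alpha> = poly p (u z) / poly q (u z)" if "z \<in> N" for z
    using form that unfolding rational_form_def by metis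
  then have "rational_on u N (\<lambda>z. - form_val u z \<alpha>)"
    unfolding rational_on_def using form(2) by (intro exI[of _ "- p"] exI[of _ q]) simp
  then have "(\<lambda>z. of_scalar (- form_val u z \<alpha>)) \<in> regular_family u P N"
    by (rule regular_family.scalar)
  then show ?case
    by (rule regular_family.cong) (simp add: val i_hat_of_form)
next
  case (add V W)
  have "(\<lambda>z. i_hat u z (V z) + i_hat u z (W z)) \<in> regular_family u P N"
    using add by (intro regular_family.add) auto
  then show ?case
    by (rule regular_family.cong)
       (use add regular_family_Wreg in \<open>auto intro!: i_hat_simps\<close>)
next
  case (mult V W)
  have "(\<lambda>z. i_hat u z (V z) * W z + V z * i_hat u z (W z)) \<in> regular_family u P N"
    using mult by (intro regular_family.add regular_family.mult) auto
  then show ?case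
    by (rule regular_family.cong)
       (use mult regular_family_Wreg in \<open>auto intro!: i_hat_simps\<close>)
next
  case (cong V W)
  have "(\<lambda>z. i_hat u z (V z)) \<in> regular_family u P N" using cong by auto
  then show ?case by (rule regular_family.cong) (use cong in auto)
qed

lemma Wreg_regular_family:
  assumes u: "is_coordinate u P" and z1: "z1 \<noteq> P" and v: "v \<in> Wreg z1"
  shows "\<exists>N. finite (- N) \<and> z1 \<in> N \<and> P \<notin> N \<and> (\<lambda>z. v) \<in> regular_family u P N"
  using v
proof induction
  case (scalar c)
  show ?case
    by (rule exI[of _ "- {P}"]) (use z1 in \<open>auto intro: regular_family.scalar rational_on_const\<close>)
next
  case (form \<alpha>)
  obtain p q where pq: "poly q (u z1) \<noteq> 0" "rational_form u P \<alpha> p q"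
    using regular_form_rational[OF u z1 form] by blast
  define N where "N = {z. z \<noteq> P \<and> poly q (u z) \<noteq> 0}"
  have "- N = {P} \<union> {z. z \<noteq> P \<and> poly q (u z) = 0}" by (auto simp: N_def)
  moreover have "q \<noteq> 0" using pq by auto
  ultimately have "finite (- N)" using finite_coordinate_roots[OF u] by simp
  moreover have "(\<lambda>z. of_form \<alpha>) \<in> regular_family u P N"
    using pq(2) by (rule regular_family.form) (simp add: N_def)
  ultimately show ?case using z1 pq(1) by (intro exI[of _ N]) (simp add: N_def)
next
  case (add v w)
  then obtain N N' where "finite (- N)" "z1 \<in> N" "P \<notin> N" "(\<lambda>z. v) \<in> regular_family u P N"
     "finite (- N')" "z1 \<in> N'" "(\<lambda>z. w) \<in> regular_family u P N'" by blast
  then show ?case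
    by (intro exI[of _ "N \<inter> N'"])
       (auto intro: regular_family.add regular_family_antimono[of _ u P N] regular_family_antimono[of _ u P N'])
next
  case (mult v w)
  then obtain N N' where "finite (- N)" "z1 \<in> N" "P \<notin> N" "(\<lambda>z. v) \<in> regular_family u P N"
     "finite (- N')" "z1 \<in> N'" "(\<lambda>z. w) \<in> regular_family u P N'" by blast
  then show ?case
    by (intro exI[of _ "N \<inter> N'"])
       (auto intro: regular_family.mult regular_family_antimono[of _ u P N] regular_family_antimono[of _ u P N'])
qed

section \<open>Rational functions of a point and auxiliary points\<close>

lemma poly_fun_minus: "poly_fun m f \<Longrightarrow> poly_fun m g \<Longrightarrow> poly_fun m (\<lambda>t ys. f t ys - g t ys)"
  using poly_fun.add[of m f "\<lambda>t ys. - 1 * g t ys"] poly_fun.mult[OF poly_fun.const[of m "- 1"], of g] by simp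

lemma poly_fun_power: "poly_fun m f \<Longrightarrow> poly_fun m (\<lambda>t ys. f t ys ^ n)"
  by (induction n) (auto intro: poly_fun.const poly_fun.mult)

lemma poly_fun_poly: "poly_fun m f \<Longrightarrow> poly_fun m (\<lambda>t ys. poly p (f t ys))"
  by (induction p) (auto intro: poly_fun.const poly_fun.mult poly_fun.add)

lemma poly_fun_specialize: "poly_fun m f \<Longrightarrow> poly_fun m (\<lambda>t ys. f s ys)"
  by (induction rule: poly_fun.induct) (auto intro: poly_fun.intros)

lemma poly_fun_tl: "poly_fun m f \<Longrightarrow> \<exists>f'. poly_fun (Suc m) f' \<and> (\<forall>t y ys. f' t (y # ys) = f t ys)"
proof (induction rule: poly_fun.induct)
  case (var i)
  then show ?case by (intro exI[of _ "\<lambda>t ys. ys ! Suc i"]) (simp add: poly_fun.var)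
next
  case (add f g)
  then obtain f' g' where "poly_fun (Suc m) f'" "\<forall>t y ys. f' t (y # ys) = f t ys"
    "poly_fun (Suc m) g'" "\<forall>t y ys. g' t (y # ys) = g t ys" by blast
  then show ?case by (intro exI[of _ "\<lambda>t ys. f' t ys + g' t ys"]) (simp add: poly_fun.add)
next
  case (mult f g)
  then obtain f' g' where "poly_fun (Suc m) f'" "\<forall>t y ys. f' t (y # ys) = f t ys"
    "poly_fun (Suc m) g'" "\<forall>t y ys. g' t (y # ys) = g t ys" by blast
  then show ?case by (intro exI[of _ "\<lambda>t ys. f' t ys * g' t ys"]) (simp add: poly_fun.mult)
qed (auto intro: poly_fun.const poly_fun.param)

lemma poly_fun_hd:
  assumes "poly_fun 1 f"
  shows "\<exists>f'. poly_fun (Suc m) f' \<and> (\<forall>t y ys. f' t (y # ys) = f t [y])"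
  using assms
proof (induction rule: poly_fun.induct)
  case (var i)
  then show ?case by (intro exI[of _ "\<lambda>t ys. ys ! 0"]) (simp add: poly_fun.var)
next
  case (add f g)
  then obtain f' g' where "poly_fun (Suc m) f'" "\<forall>t y ys. f' t (y # ys) = f t [y]"
    "poly_fun (Suc m) g'" "\<forall>t y ys. g' t (y # ys) = g t [y]" by blast
  then show ?case by (intro exI[of _ "\<lambda>t ys. f' t ys + g' t ys"]) (simp add: poly_fun.add)
next
  case (mult f g)
  then obtain f' g' where "poly_fun (Suc m) f'" "\<forall>t y ys. f' t (y # ys) = f t [y]"
    "poly_fun (Suc m) g'" "\<forall>t y ys. g' t (y # ys) = g t [y]" by blast
  then show ?case by (intro exI[of _ "\<lambda>t ys. f' t ys * g' t ys"]) (simp add: poly_fun.mult)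
qed (auto intro: poly_fun.const poly_fun.param)

lemma poly_fun_curve:
  assumes "poly_fun m f" "\<And>i. i < m \<Longrightarrow> \<exists>p. \<forall>s. l s ! i = poly p s"
  shows "\<exists>p. \<forall>s. f (poly r s) (l s) = poly p s"
  using assms(1)
proof (induction rule: poly_fun.induct)
  case (const c)
  show ?case by (intro exI[of _ "[:c:]"]) simp
next
  case (add f g)
  then obtain p q where "\<forall>s. f (poly r s) (l s) = poly p s" "\<forall>s. g (poly r s) (l s) = poly q s" by blast
  then show ?case by (intro exI[of _ "p + q"]) simp
next
  case (mult f g)
  then obtain p q where "\<forall>s. f (poly r s) (l s) = poly p s" "\<forall>s. g (poly r s) (l s) = poly q s" by blast
  then show ?case by (intro exI[of _ "p * q"]) simp
qed (use assms(2) in auto)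

lemma poly_fun_in_parameter:
  assumes "poly_fun m f" obtains p where "\<And>t. f t ys = poly p t"
proof -
  have "\<exists>p. \<forall>s. f (poly [:0, 1:] s) ys = poly p s"
    using assms by (rule poly_fun_curve[where l = "\<lambda>_. ys"]) (rule_tac x = "[:ys ! i:]" in exI, simp)
  then show thesis using that by auto
qed

text \<open>Polynomials in several variables form an integral domain. The proof restricts both polynomials
  to the line through the points where they do not vanish.\<close>

lemma poly_fun_common_nonzero:
  assumes "poly_fun m f" "poly_fun m g" "length ys = m" "f t ys \<noteq> 0" "length ys' = m" "g t ys' \<noteq> 0"
  shows "\<exists>zs. length zs = m \<and> f t zs \<noteq> 0 \<and> g t zs \<noteq> 0"
proof -
  define l where "l s = map2 (\<lambda>a b. a + s * (b - a)) ys ys'" for s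
  have l: "\<exists>p. \<forall>s. l s ! i = poly p s" if "i < m" for i
    using that assms(3,5) by (intro exI[of _ "[:ys ! i, ys' ! i - ys ! i:]"]) (simp add: l_def)
  have l0: "l 0 = ys" "l 1 = ys'" "length (l s) = m" for s
    using assms(3,5) by (auto simp: l_def intro: nth_equalityI)
  obtain p where p: "\<And>s. f (poly [:t:] s) (l s) = poly p s" using poly_fun_curve[OF assms(1) l] by blast
  obtain q where q: "\<And>s. g (poly [:t:] s) (l s) = poly q s" using poly_fun_curve[OF assms(2) l] by blast
  have "p \<noteq> 0" "q \<noteq> 0" using p[of 0] q[of 1] l0 assms(4,6) by auto
  then obtain s where "poly (p * q) s \<noteq> 0" using poly_all_0_iff_0[of "p * q"] by auto
  then show ?thesis using p[of s] q[of s] l0 by (intro exI[of _ "l s"]) auto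
qed

text \<open>The function \<open>h\<close> of \<open>z\<close> in \<open>N\<close> and of \<open>m\<close> auxiliary points is a rational function, in the
  coordinates \<open>u\<close> of the points, without a pole along \<open>z = z1\<close>. For \<open>z1\<close> in \<open>N\<close> this includes the
  statement that \<open>h z1\<close> is the restriction of the rational function.\<close>

definition ratfun ::
  "(cp1 \<Rightarrow> complex) \<Rightarrow> cp1 \<Rightarrow> cp1 set \<Rightarrow> cp1 \<Rightarrow> nat \<Rightarrow> (cp1 \<Rightarrow> cp1 list \<Rightarrow> complex) \<Rightarrow> bool" where
  "ratfun u P N z1 m h \<longleftrightarrow>
     (\<exists>A B. poly_fun m A \<and> poly_fun m B \<and> (\<exists>ys. length ys = m \<and> B (u z1) ys \<noteq> 0) \<and>
        (\<forall>z\<in>N. \<forall>xs. length xs = m \<longrightarrow> P \<notin> set xs \<longrightarrow> B (u z) (map u xs) \<noteq> 0 \<longrightarrow>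
           h z xs = A (u z) (map u xs) / B (u z) (map u xs)))"

lemma ratfunI:
  assumes "poly_fun m A" "poly_fun m B" "length ys = m" "B (u z1) ys \<noteq> 0"
    "\<And>z xs. z \<in> N \<Longrightarrow> length xs = m \<Longrightarrow> P \<notin> set xs \<Longrightarrow> B (u z) (map u xs) \<noteq> 0 \<Longrightarrow>
       h z xs = A (u z) (map u xs) / B (u z) (map u xs)"
  shows "ratfun u P N z1 m h"
  unfolding ratfun_def using assms by blast

lemma ratfunE:
  assumes "ratfun u P N z1 m h"
  obtains A B ys where "poly_fun m A" "poly_fun m B" "length ys = m" "B (u z1) ys \<noteq> 0"
    "\<And>z xs. z \<in> N \<Longrightarrow> length xs = m \<Longrightarrow> P \<notin> set xs \<Longrightarrow> B (u z) (map u xs) \<noteq> 0 \<Longrightarrow>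
       h z xs = A (u z) (map u xs) / B (u z) (map u xs)"
  using assms unfolding ratfun_def by blast

lemma ratfun_cong:
  assumes "ratfun u P N z1 m h" "\<And>z xs. z \<in> N \<Longrightarrow> length xs = m \<Longrightarrow> h' z xs = h z xs"
  shows "ratfun u P N z1 m h'"
  using assms(1) by (rule ratfunE) (rule ratfunI, use assms(2) in auto)

lemma ratfun_const: "ratfun u P N z1 m (\<lambda>z xs. c)"
  by (rule ratfunI[where A = "\<lambda>_ _. c" and B = "\<lambda>_ _. 1" and ys = "replicate m 0"]) (auto intro: poly_fun.const)

lemma ratfun_rational_on:
  assumes "rational_on u N r" "z1 \<in> N" shows "ratfun u P N z1 m (\<lambda>z xs. r z)"
proof -
  obtain p q where "\<forall>z\<in>N. poly q (u z) \<noteq> 0 \<and> r z = poly p (u z) / poly q (u z)"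
    using assms(1) unfolding rational_on_def by blast
  then show ?thesis using assms(2)
    by (intro ratfunI[where A = "\<lambda>t _. poly p t" and B = "\<lambda>t _. poly q t" and ys = "replicate m 0"])
       (auto intro: poly_fun_poly poly_fun.param)
qed

lemma ratfun_add:
  assumes "ratfun u P N z1 m h" "ratfun u P N z1 m k"
  shows "ratfun u P N z1 m (\<lambda>z xs. h z xs + k z xs)"
proof -
  obtain A B ys where 1: "poly_fun m A" "poly_fun m B" "length ys = m" "B (u z1) ys \<noteq> 0"
    "\<And>z xs. z \<in> N \<Longrightarrow> length xs = m \<Longrightarrow> P \<notin> set xs \<Longrightarrow> B (u z) (map u xs) \<noteq> 0 \<Longrightarrow>
       h z xs = A (u z) (map u xs) / B (u z) (map u xs)"
    using assms(1) by (rule ratfunE) blast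
  obtain A' B' ys' where 2: "poly_fun m A'" "poly_fun m B'" "length ys' = m" "B' (u z1) ys' \<noteq> 0"
    "\<And>z xs. z \<in> N \<Longrightarrow> length xs = m \<Longrightarrow> P \<notin> set xs \<Longrightarrow> B' (u z) (map u xs) \<noteq> 0 \<Longrightarrow>
       k z xs = A' (u z) (map u xs) / B' (u z) (map u xs)"
    using assms(2) by (rule ratfunE) blast
  obtain zs where zs: "length zs = m" "B (u z1) zs \<noteq> 0" "B' (u z1) zs \<noteq> 0"
    using poly_fun_common_nonzero[of m B B' ys "u z1" ys'] 1 2 by blast
  show ?thesis
  proof (rule ratfunI[OF _ _ zs(1)])
    show "poly_fun m (\<lambda>t ys. A t ys * B' t ys + A' t ys * B t ys)" "poly_fun m (\<lambda>t ys. B t ys * B' t ys)"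
      by (intro poly_fun.add poly_fun.mult 1 2)+
  qed (use zs in \<open>auto simp: 1(5) 2(5) add_divide_distrib\<close>)
qed

lemma ratfun_mult:
  assumes "ratfun u P N z1 m h" "ratfun u P N z1 m k"
  shows "ratfun u P N z1 m (\<lambda>z xs. h z xs * k z xs)"
proof -
  obtain A B ys where 1: "poly_fun m A" "poly_fun m B" "length ys = m" "B (u z1) ys \<noteq> 0"
    "\<And>z xs. z \<in> N \<Longrightarrow> length xs = m \<Longrightarrow> P \<notin> set xs \<Longrightarrow> B (u z) (map u xs) \<noteq> 0 \<Longrightarrow>
       h z xs = A (u z) (map u xs) / B (u z) (map u xs)"
    using assms(1) by (rule ratfunE) blast
  obtain A' B' ys' where 2: "poly_fun m A'" "poly_fun m B'" "length ys' = m" "B' (u z1) ys' \<noteq> 0"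
    "\<And>z xs. z \<in> N \<Longrightarrow> length xs = m \<Longrightarrow> P \<notin> set xs \<Longrightarrow> B' (u z) (map u xs) \<noteq> 0 \<Longrightarrow>
       k z xs = A' (u z) (map u xs) / B' (u z) (map u xs)"
    using assms(2) by (rule ratfunE) blast
  obtain zs where zs: "length zs = m" "B (u z1) zs \<noteq> 0" "B' (u z1) zs \<noteq> 0"
    using poly_fun_common_nonzero[of m B B' ys "u z1" ys'] 1 2 by blast
  show ?thesis
  proof (rule ratfunI[OF _ _ zs(1)])
    show "poly_fun m (\<lambda>t ys. A t ys * A' t ys)" "poly_fun m (\<lambda>t ys. B t ys * B' t ys)"
      by (intro poly_fun.mult 1 2)+
  qed (use zs in \<open>auto simp: 1(5) 2(5)\<close>)
qed

lemma ratfun_sum_mset: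
  "(\<And>a. a \<in># M \<Longrightarrow> ratfun u P N z1 m (h a)) \<Longrightarrow> ratfun u P N z1 m (\<lambda>z xs. \<Sum>a\<in>#M. h a z xs)"
proof (induction M)
  case (add a M)
  then show ?case using ratfun_add[of u P N z1 m "h a" "\<lambda>z xs. \<Sum>a\<in>#M. h a z xs"] by simp
qed (simp add: ratfun_const)

lemma ratfun_tl:
  assumes "ratfun u P N z1 m h" shows "ratfun u P N z1 (Suc m) (\<lambda>z xs. h z (tl xs))"
proof -
  obtain A B ys where 1: "poly_fun m A" "poly_fun m B" "length ys = m" "B (u z1) ys \<noteq> 0"
    "\<And>z xs. z \<in> N \<Longrightarrow> length xs = m \<Longrightarrow> P \<notin> set xs \<Longrightarrow> B (u z) (map u xs) \<noteq> 0 \<Longrightarrow>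
       h z xs = A (u z) (map u xs) / B (u z) (map u xs)"
    using assms(1) by (rule ratfunE) blast
  obtain A' B' where 2: "poly_fun (Suc m) A'" "\<forall>t y ys. A' t (y # ys) = A t ys"
    "poly_fun (Suc m) B'" "\<forall>t y ys. B' t (y # ys) = B t ys"
    using poly_fun_tl 1(1,2) by meson
  show ?thesis
    by (rule ratfunI[OF 2(1,3), where ys = "0 # ys"]) (auto simp: 1 2 length_Suc_conv)
qed

lemma ratfun_hd:
  assumes "ratfun u P N z1 1 h" shows "ratfun u P N z1 (Suc m) (\<lambda>z xs. h z [hd xs])"
proof -
  obtain A B ys where 1: "poly_fun 1 A" "poly_fun 1 B" "length ys = 1" "B (u z1) ys \<noteq> 0"
    "\<And>z xs. z \<in> N \<Longrightarrow> length xs = 1 \<Longrightarrow> P \<notin> set xs \<Longrightarrow> B (u z) (map u xs) \<noteq> 0 \<Longrightarrow>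
       h z xs = A (u z) (map u xs) / B (u z) (map u xs)"
    using assms(1) by (rule ratfunE) blast
  obtain A' B' where 2: "poly_fun (Suc m) A'" "\<forall>t y ys. A' t (y # ys) = A t [y]"
    "poly_fun (Suc m) B'" "\<forall>t y ys. B' t (y # ys) = B t [y]"
    using poly_fun_hd 1(1,2) by meson
  obtain y where "ys = [y]" using 1(3) by (auto simp: length_Suc_conv)
  then show ?thesis
    by (intro ratfunI[OF 2(1,3), where ys = "y # replicate m 0"]) (use 1(4) in \<open>auto simp: 1(5) 2 length_Suc_conv\<close>)
qed

text \<open>A family of forms whose coefficient with respect to \<open>du\<close> is a rational function of the two
  points. The diagonal may be a pole, as it is for \<open>e_form u\<close>: only a pole along \<open>z = z1\<close>, with the
  other point arbitrary, is excluded.\<close>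

definition form_family ::
  "(cp1 \<Rightarrow> complex) \<Rightarrow> cp1 \<Rightarrow> cp1 set \<Rightarrow> cp1 \<Rightarrow> (cp1 \<Rightarrow> kform) \<Rightarrow> bool" where
  "form_family u P N z1 \<gamma> \<longleftrightarrow> ratfun u P N z1 1 (\<lambda>z xs. form_val u (hd xs) (\<gamma> z))"

lemma form_family_const:
  assumes "rational_form u P \<alpha> p q" "q \<noteq> 0"
  shows "form_family u P N z1 (\<lambda>z. \<alpha>)"
proof -
  obtain y where y: "poly q y \<noteq> 0" using assms(2) poly_all_0_iff_0 by blast
  show ?thesis
    unfolding form_family_def
  proof (rule ratfunI[where A = "\<lambda>t ys. poly p (ys ! 0)" and B = "\<lambda>t ys. poly q (ys ! 0)" and ys = "[y]"])
    fix z and xs :: "cp1 list" assume "length xs = 1" "P \<notin> set xs" "poly q (map u xs ! 0) \<noteq> 0"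
    then show "form_val u (hd xs) \<alpha> = poly p (map u xs ! 0) / poly q (map u xs ! 0)"
      using assms(1) by (cases xs) (auto simp: rational_form_def)
  qed (use y in \<open>auto intro: poly_fun_poly poly_fun.var\<close>)
qed

lemma form_family_e_form:
  assumes "is_coordinate u P"
  shows "form_family u P N z1 (e_form u)"
  unfolding form_family_def
proof (rule ratfunI[where A = "\<lambda>t ys. -1" and B = "\<lambda>t ys. (ys ! 0 - t) ^ 2" and ys = "[u z1 + 1]"])
  fix z xs assume "length xs = 1" "P \<notin> set xs" "(map u xs ! 0 - u z) ^ 2 \<noteq> 0"
  then show "form_val u (hd xs) (e_form u z) = -1 / (map u xs ! 0 - u z) ^ 2"
    using rational_form_e_form[OF assms, of z] by (cases xs) (auto simp: rational_form_def)
next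
  show "poly_fun 1 (\<lambda>t ys. (ys ! 0 - t) ^ 2)"
    by (intro poly_fun_power poly_fun_minus poly_fun.var poly_fun.param) simp
qed (auto intro: poly_fun.const)

lemma ratfun_form_perm:
  "(\<And>\<gamma>. \<gamma> \<in># \<Gamma> \<Longrightarrow> form_family u P N z1 \<gamma>) \<Longrightarrow>
   ratfun u P N z1 m (\<lambda>z xs. form_perm u (image_mset (\<lambda>\<gamma>. \<gamma> z) \<Gamma>) xs)"
proof (induction m arbitrary: \<Gamma>)
  case 0
  show ?case
    by (rule ratfun_cong[OF ratfun_const[where c = "if \<Gamma> = {#} then 1 else 0"]]) simp
next
  case (Suc m)
  have "ratfun u P N z1 (Suc m) (\<lambda>z xs. \<Sum>\<gamma>\<in>#\<Gamma>. form_val u (hd xs) (\<gamma> z) *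
      form_perm u (image_mset (\<lambda>\<gamma>. \<gamma> z) (\<Gamma> - {#\<gamma>#})) (tl xs))"
  proof (intro ratfun_sum_mset ratfun_mult)
    fix \<gamma> assume \<gamma>: "\<gamma> \<in># \<Gamma>"
    show "ratfun u P N z1 (Suc m) (\<lambda>z xs. form_val u (hd xs) (\<gamma> z))"
      using ratfun_hd Suc.prems[OF \<gamma>] unfolding form_family_def by fastforce
    show "ratfun u P N z1 (Suc m) (\<lambda>z xs. form_perm u (image_mset (\<lambda>\<gamma>. \<gamma> z) (\<Gamma> - {#\<gamma>#})) (tl xs))"
      by (rule ratfun_tl[OF Suc.IH]) (auto dest: in_diffD intro: Suc.prems)
  qed
  then show ?case
  proof (rule ratfun_cong)
    fix z and xs :: "cp1 list" assume "length xs = Suc m"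
    then obtain x xs' where xs: "xs = x # xs'" by (auto simp: length_Suc_conv)
    have "image_mset (\<lambda>\<gamma>. form_val u x (\<gamma> z) * form_perm u (image_mset (\<lambda>\<gamma>. \<gamma> z) \<Gamma> - {#\<gamma> z#}) xs') \<Gamma> =
       image_mset (\<lambda>\<gamma>. form_val u x (\<gamma> z) * form_perm u (image_mset (\<lambda>\<gamma>. \<gamma> z) (\<Gamma> - {#\<gamma>#})) xs') \<Gamma>"
      by (intro image_mset_cong) (simp add: image_mset_Diff)
    then show "form_perm u (image_mset (\<lambda>\<gamma>. \<gamma> z) \<Gamma>) xs = (\<Sum>\<gamma>\<in>#\<Gamma>. form_val u (hd xs) (\<gamma> z) *
      form_perm u (image_mset (\<lambda>\<gamma>. \<gamma> z) (\<Gamma> - {#\<gamma>#})) (tl xs))"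
      by (simp add: xs image_mset.compositionality o_def)
  qed
qed

text \<open>Sums of monomials in such families of forms with rational coefficients. In contrast to
  \<open>regular_family\<close>, the forms \<open>e_form u z\<close> are admitted. Sums of monomials are taken as the definition
  because \<open>polydiff\<close> has no simple expression on products.\<close>

inductive_set rational_family ::
  "(cp1 \<Rightarrow> complex) \<Rightarrow> cp1 \<Rightarrow> cp1 set \<Rightarrow> cp1 \<Rightarrow> (cp1 \<Rightarrow> symK) set" for u P N z1 where
  monomial: "rational_on u N r \<Longrightarrow> (\<And>\<gamma>. \<gamma> \<in># \<Gamma> \<Longrightarrow> form_family u P N z1 \<gamma>) \<Longrightarrow>
    (\<lambda>z. of_scalar (r z) * (\<Prod>\<gamma>\<in>#\<Gamma>. of_form (\<gamma> z))) \<in> rational_family u P N z1"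
| add: "V \<in> rational_family u P N z1 \<Longrightarrow> W \<in> rational_family u P N z1 \<Longrightarrow>
    (\<lambda>z. V z + W z) \<in> rational_family u P N z1"
| cong: "V \<in> rational_family u P N z1 \<Longrightarrow> \<forall>z\<in>N. W z = V z \<Longrightarrow> W \<in> rational_family u P N z1"

lemma rational_family_mult:
  assumes "V \<in> rational_family u P N z1" "W \<in> rational_family u P N z1"
  shows "(\<lambda>z. V z * W z) \<in> rational_family u P N z1"
  using assms(1)
proof (induction rule: rational_family.induct)
  case (monomial r \<Gamma>)
  show ?case
    using assms(2)
  proof (induction rule: rational_family.induct)
    case (monomial r' \<Gamma>')
    have "(\<lambda>z. of_scalar (r z * r' z) * (\<Prod>\<gamma>\<in>#\<Gamma> + \<Gamma>'. of_form (\<gamma> z))) \<in> rational_family u P N z1"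
      using monomial \<open>\<And>\<gamma>. \<gamma> \<in># \<Gamma> \<Longrightarrow> _ \<gamma>\<close> \<open>rational_on u N r\<close>
      by (intro rational_family.monomial rational_on_mult) auto
    then show ?case
      by (rule rational_family.cong) (simp add: of_scalar_mult mult_ac)
  next
    case (add V W)
    from rational_family.add[OF add.IH] show ?case by (simp add: distrib_left)
  next
    case (cong V W)
    from cong(3) show ?case by (rule rational_family.cong) (simp add: cong(2))
  qed
next
  case (add V V')
  from rational_family.add[OF add.IH] show ?case by (simp add: distrib_right)
next
  case (cong V V')
  from cong(3) show ?case by (rule rational_family.cong) (simp add: cong(2))
qed

lemma rational_family_of_form:
  assumes "form_family u P N z1 \<gamma>" shows "(\<lambda>z. of_form (\<gamma> z)) \<in> rational_family u P N z1"
  using rational_family.monomial[OF rational_on_const[of u N 1], of "{#\<gamma>#}" P z1] assms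
  by (simp add: of_scalar_1)

lemma regular_family_rational:
  assumes "V \<in> regular_family u P N" "z1 \<in> N" shows "V \<in> rational_family u P N z1"
  using assms
proof (induction rule: regular_family.induct)
  case (scalar r)
  then show ?case using rational_family.monomial[of u N r "{#}"] by simp
next
  case (form \<alpha> p q)
  then have "q \<noteq> 0" by auto
  then show ?case using rational_family_of_form[OF form_family_const[OF form(1)]] by blast
qed (auto intro: rational_family.add rational_family_mult rational_family.cong)

lemma ratfun_polydiff:
  assumes "V \<in> rational_family u P N z1" "z1 \<in> N"
  shows "ratfun u P N z1 m (\<lambda>z xs. polydiff u (V z) xs)"
  using assms(1)
proof (induction rule: rational_family.induct)
  case (monomial r \<Gamma>)
  have "ratfun u P N z1 m (\<lambda>z xs. r z * (form_perm u (image_mset (\<lambda>\<gamma>. \<gamma> z) \<Gamma>) xs * (1 / fact m)))"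
    by (intro ratfun_mult ratfun_const ratfun_rational_on ratfun_form_perm monomial assms(2))
  then show ?case
  proof (rule ratfun_cong)
    fix z and xs :: "cp1 list" assume "length xs = m"
    then show "polydiff u (of_scalar (r z) * (\<Prod>\<gamma>\<in>#\<Gamma>. of_form (\<gamma> z))) xs =
       r z * (form_perm u (image_mset (\<lambda>\<gamma>. \<gamma> z) \<Gamma>) xs * (1 / fact m))"
      using polydiff_monomial[of u "r z" "image_mset (\<lambda>\<gamma>. \<gamma> z) \<Gamma>" xs]
      by (simp add: image_mset.compositionality o_def)
  qed
next
  case (add V W)
  from ratfun_add[OF add.IH] show ?case by (simp add: polydiff_add)
next
  case (cong V W)
  from cong(3) show ?case by (rule ratfun_cong) (simp add: cong(2))
qed

section \<open>Derivatives along the coordinate vector field\<close>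

lemma ddu_comp:
  assumes u: "is_coordinate u P" "z \<noteq> P" and S: "finite S" "z \<notin> S"
    and F: "\<And>w. w \<notin> S \<Longrightarrow> F w = \<phi> (u w)" and \<phi>: "\<phi> field_differentiable at (u z)"
  shows "ddu u F z = deriv \<phi> (u z)"
proof -
  obtain d where d: "((u \<circ> chart z) has_field_derivative d) (at 0)" "d \<noteq> 0"
    using coordinate_pullback[OF u] by blast
  have c0: "chart z 0 = z" by (cases z) (auto simp: chart_def)
  have "eventually (\<lambda>t. chart z t \<notin> S) (at 0)"
    by (rule chart_eventually_notin_finite[OF S(1)])
  then have "eventually (\<lambda>t. chart z t \<notin> S) (nhds 0)"
    using S(2) c0 by (auto simp: eventually_nhds_conv_at)
  then have "eventually (\<lambda>t. (F \<circ> chart z) t = (\<phi> \<circ> (u \<circ> chart z)) t) (nhds 0)"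
    by eventually_elim (simp add: F)
  then have "deriv (F \<circ> chart z) 0 = deriv (\<phi> \<circ> (u \<circ> chart z)) 0"
    by (rule deriv_cong_ev) simp
  moreover have "(\<phi> has_field_derivative deriv \<phi> (u z)) (at ((u \<circ> chart z) 0))"
    using \<phi> c0 by (simp add: DERIV_deriv_iff_field_differentiable)
  then have "((\<phi> \<circ> (u \<circ> chart z)) has_field_derivative deriv \<phi> (u z) * d) (at 0)"
    using d(1) by (rule DERIV_chain)
  ultimately show ?thesis
    using d DERIV_imp_deriv unfolding ddu_def by (metis nonzero_mult_div_cancel_right)
qed

text \<open>The function \<open>h\<close> is the second-order remainder, so its value at \<open>w\<close> is half the second
  derivative.\<close>

lemma second_order_expansion:
  fixes \<phi> h :: "complex \<Rightarrow> complex"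
  assumes h: "h analytic_on {w}"
    and \<phi>: "eventually (\<lambda>t. \<phi> t = c0 + (t - w) * c1 + (t - w) ^ 2 * h t) (nhds w)"
  shows "deriv \<phi> w = c1" "deriv (deriv \<phi>) w = 2 * h w"
proof -
  have ev: "eventually (\<lambda>t. deriv \<phi> t = c1 + 2 * (t - w) * h t + (t - w) ^ 2 * deriv h t) (nhds w)"
  proof -
    have "eventually (\<lambda>t. h analytic_on {t}) (nhds w)"
      using h unfolding analytic_at eventually_nhds by (metis holomorphic_on_imp_analytic_at)
    moreover have "eventually (\<lambda>t. eventually (\<lambda>t. \<phi> t = c0 + (t - w) * c1 + (t - w) ^ 2 * h t) (nhds t)) (nhds w)"
      using \<phi> by (simp add: eventually_eventually)
    ultimately show ?thesis
    proof eventually_elim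
      case (elim t)
      have "(h has_field_derivative deriv h t) (at t)"
        using elim(1) analytic_on_imp_differentiable_at DERIV_deriv_iff_field_differentiable by blast
      then have "((\<lambda>t. c0 + (t - w) * c1 + (t - w) ^ 2 * h t) has_field_derivative
          (c1 + 2 * (t - w) * h t + (t - w) ^ 2 * deriv h t)) (at t)"
        by (auto intro!: derivative_eq_intros)
      from DERIV_imp_deriv[OF this] show ?case
        unfolding deriv_cong_ev[OF elim(2) refl] .
    qed
  qed
  show "deriv \<phi> w = c1" using eventually_nhds_x_imp_x[OF ev] by simp
  have "(h has_field_derivative deriv h w) (at w)"
    "(deriv h has_field_derivative deriv (deriv h) w) (at w)"
    using analytic_on_imp_differentiable_at[OF h] analytic_on_imp_differentiable_at[OF analytic_deriv[OF h]]
    by (simp_all add: DERIV_deriv_iff_field_differentiable)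
  then have "((\<lambda>t. c1 + 2 * (t - w) * h t + (t - w) ^ 2 * deriv h t) has_field_derivative 2 * h w) (at w)"
    by (auto intro!: derivative_eq_intros)
  from DERIV_imp_deriv[OF this] show "deriv (deriv \<phi>) w = 2 * h w"
    unfolding deriv_cong_ev[OF ev refl] .
qed

text \<open>Taylor expansion to second order in the parameter, with a polynomial remainder.\<close>

lemma poly_fun_expansion:
  assumes "poly_fun m f"
  shows "\<exists>f1 f2. poly_fun m (\<lambda>t. f1) \<and> poly_fun m f2 \<and>
    (\<forall>t ys. f t ys = f s ys + (t - s) * f1 ys + (t - s) ^ 2 * f2 t ys)"
  using assms
proof (induction rule: poly_fun.induct)
  case (param)
  show ?case
    by (intro exI[of _ "\<lambda>ys. 1"] exI[of _ "\<lambda>t ys. 0"]) (auto intro: poly_fun.const)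
next
  case (add f g)
  then obtain f1 f2 g1 g2 where fg: "poly_fun m (\<lambda>t. f1)" "poly_fun m f2"
    "\<forall>t ys. f t ys = f s ys + (t - s) * f1 ys + (t - s) ^ 2 * f2 t ys"
    "poly_fun m (\<lambda>t. g1)" "poly_fun m g2"
    "\<forall>t ys. g t ys = g s ys + (t - s) * g1 ys + (t - s) ^ 2 * g2 t ys"
    by blast
  show ?case
  proof (intro exI conjI allI)
    show "poly_fun m (\<lambda>t ys. f1 ys + g1 ys)" "poly_fun m (\<lambda>t ys. f2 t ys + g2 t ys)"
      by (intro poly_fun.add fg)+
    fix t ys
    show "f t ys + g t ys = f s ys + g s ys + (t - s) * (f1 ys + g1 ys) + (t - s) ^ 2 * (f2 t ys + g2 t ys)"
      by (subst fg(3)[rule_format], subst fg(6)[rule_format]) (simp add: algebra_simps)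
  qed
next
  case (mult f g)
  then obtain f1 f2 g1 g2 where fg: "poly_fun m (\<lambda>t. f1)" "poly_fun m f2"
    "\<forall>t ys. f t ys = f s ys + (t - s) * f1 ys + (t - s) ^ 2 * f2 t ys"
    "poly_fun m (\<lambda>t. g1)" "poly_fun m g2"
    "\<forall>t ys. g t ys = g s ys + (t - s) * g1 ys + (t - s) ^ 2 * g2 t ys"
    by blast
  define k where "k t ys = f s ys * g2 t ys + f1 ys * g1 ys + f2 t ys * g s ys +
     (t - s) * (f1 ys * g2 t ys + f2 t ys * g1 ys) + (t - s) ^ 2 * (f2 t ys * g2 t ys)" for t ys
  show ?case
  proof (intro exI conjI allI)
    show "poly_fun m (\<lambda>t ys. f s ys * g1 ys + f1 ys * g s ys)"
      by (intro poly_fun.add poly_fun.mult fg poly_fun_specialize mult(1,2))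
    show "poly_fun m k"
      unfolding k_def[abs_def]
      by (intro poly_fun.add poly_fun.mult poly_fun_power poly_fun_minus poly_fun.param poly_fun.const
            fg poly_fun_specialize mult(1,2))
    fix t ys
    have "(a0 + x * a1 + x ^ 2 * a2) * (b0 + x * b1 + x ^ 2 * b2) = a0 * b0 + x * (a0 * b1 + a1 * b0) +
      x ^ 2 * (a0 * b2 + a1 * b1 + a2 * b0 + x * (a1 * b2 + a2 * b1) + x ^ 2 * (a2 * b2))"
      for a0 a1 a2 b0 b1 b2 x :: complex
      by (simp add: algebra_simps power2_eq_square)
    then show "f t ys * g t ys = f s ys * g s ys + (t - s) * (f s ys * g1 ys + f1 ys * g s ys) + (t - s) ^ 2 * k t ys"
      unfolding k_def by (subst fg(3)[rule_format], subst fg(6)[rule_format])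
  qed
qed (auto intro!: exI[of _ "\<lambda>ys. 0"] exI[of _ "\<lambda>t ys. 0"] poly_fun.const)

section \<open>Limits on the diagonal\<close>

lemma has_polydiff_limit_ratfun:
  assumes "ratfun u P N z1 m h" "z1 \<in> N"
  shows "has_polydiff_limit u P N m z1 h (h z1)"
proof -
  obtain A B ys where 1: "poly_fun m A" "poly_fun m B" "length ys = m" "B (u z1) ys \<noteq> 0"
    "\<And>z xs. z \<in> N \<Longrightarrow> length xs = m \<Longrightarrow> P \<notin> set xs \<Longrightarrow> B (u z) (map u xs) \<noteq> 0 \<Longrightarrow>
       h z xs = A (u z) (map u xs) / B (u z) (map u xs)"
    using assms(1) by (rule ratfunE) blast
  then show ?thesis
    unfolding has_polydiff_limit_def using assms(2) by (intro exI[of _ A] exI[of _ B]) auto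
qed

lemma has_polydiff_limit_add:
  assumes "has_polydiff_limit u P N m z1 E L" "has_polydiff_limit u P N m z1 E' L'"
  shows "has_polydiff_limit u P N m z1 (\<lambda>z xs. E z xs + E' z xs) (\<lambda>xs. L xs + L' xs)"
proof -
  obtain A B where 1: "poly_fun m A" "poly_fun m B" "\<exists>ys. length ys = m \<and> B (u z1) ys \<noteq> 0"
    "\<forall>z2 xs. z2 \<in> N - {z1} \<longrightarrow> length xs = m \<longrightarrow> P \<notin> set xs \<longrightarrow> B (u z2) (map u xs) \<noteq> 0 \<longrightarrow>
       E z2 xs = A (u z2) (map u xs) / B (u z2) (map u xs)"
    "\<forall>xs. length xs = m \<longrightarrow> P \<notin> set xs \<longrightarrow> B (u z1) (map u xs) \<noteq> 0 \<longrightarrow>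
       L xs = A (u z1) (map u xs) / B (u z1) (map u xs)"
    using assms(1) unfolding has_polydiff_limit_def by blast
  obtain A' B' where 2: "poly_fun m A'" "poly_fun m B'" "\<exists>ys. length ys = m \<and> B' (u z1) ys \<noteq> 0"
    "\<forall>z2 xs. z2 \<in> N - {z1} \<longrightarrow> length xs = m \<longrightarrow> P \<notin> set xs \<longrightarrow> B' (u z2) (map u xs) \<noteq> 0 \<longrightarrow>
       E' z2 xs = A' (u z2) (map u xs) / B' (u z2) (map u xs)"
    "\<forall>xs. length xs = m \<longrightarrow> P \<notin> set xs \<longrightarrow> B' (u z1) (map u xs) \<noteq> 0 \<longrightarrow>
       L' xs = A' (u z1) (map u xs) / B' (u z1) (map u xs)"
    using assms(2) unfolding has_polydiff_limit_def by blast
  obtain zs where zs: "length zs = m" "B (u z1) zs \<noteq> 0" "B' (u z1) zs \<noteq> 0"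
    using poly_fun_common_nonzero[OF 1(2) 2(2)] 1(3) 2(3) by blast
  show ?thesis
    unfolding has_polydiff_limit_def
  proof (intro exI conjI)
    show "poly_fun m (\<lambda>t ys. A t ys * B' t ys + A' t ys * B t ys)" "poly_fun m (\<lambda>t ys. B t ys * B' t ys)"
      by (intro poly_fun.add poly_fun.mult 1 2)+
    show "length zs = m" "B (u z1) zs * B' (u z1) zs \<noteq> 0" using zs by auto
  qed (simp_all add: 1(4,5) 2(4,5) add_divide_distrib)
qed

lemma has_polydiff_limit_cong:
  assumes "has_polydiff_limit u P N m z1 E L"
    "\<And>z xs. z \<in> N - {z1} \<Longrightarrow> E' z xs = E z xs" "\<And>xs. L' xs = L xs"
  shows "has_polydiff_limit u P N m z1 E' L'"
  using assms(1) unfolding has_polydiff_limit_def by (simp add: assms(2,3))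

text \<open>The second-order Taylor remainder of a rational family, divided by half the square of the
  increment of \<open>u\<close>, tends to the second derivative. For a quotient \<open>A/B\<close> the numerator \<open>H\<close> of the
  remainder is computed from the expansions of \<open>A\<close> and \<open>B\<close>; the remainder has the denominator
  \<open>B(t) B(w)\<^sup>2\<close>, which does not vanish identically on \<open>t = w\<close>.\<close>

lemma has_polydiff_limit_taylor:
  assumes u: "is_coordinate u P" and N: "finite (- N)" "z1 \<in> N" "P \<notin> N"
    and F: "ratfun u P N z1 m F"
  shows "has_polydiff_limit u P N m z1
    (\<lambda>z xs. 2 / (u z - u z1) ^ 2 * (F z xs - F z1 xs - (u z - u z1) * ddu u (\<lambda>z. F z xs) z1))
    (\<lambda>xs. ddu u (ddu u (\<lambda>z. F z xs)) z1)"
proof -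
  define w where "w = u z1"
  obtain A B ys where 1: "poly_fun m A" "poly_fun m B" "length ys = m" "B w ys \<noteq> 0"
    "\<And>z xs. z \<in> N \<Longrightarrow> length xs = m \<Longrightarrow> P \<notin> set xs \<Longrightarrow> B (u z) (map u xs) \<noteq> 0 \<Longrightarrow>
       F z xs = A (u z) (map u xs) / B (u z) (map u xs)"
    using F unfolding w_def by (rule ratfunE) blast
  obtain A1 A2 where A: "poly_fun m (\<lambda>t. A1)" "poly_fun m A2"
    "\<And>t ys. A t ys = A w ys + (t - w) * A1 ys + (t - w) ^ 2 * A2 t ys"
    using poly_fun_expansion[OF 1(1), of w] by blast
  obtain B1 B2 where B: "poly_fun m (\<lambda>t. B1)" "poly_fun m B2"
    "\<And>t ys. B t ys = B w ys + (t - w) * B1 ys + (t - w) ^ 2 * B2 t ys"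
    using poly_fun_expansion[OF 1(2), of w] by blast
  define C where "C ys = A1 ys * B w ys - A w ys * B1 ys" for ys
  define H where "H t ys = A2 t ys * B w ys ^ 2 - A w ys * B w ys * B2 t ys - C ys * (B1 ys + (t - w) * B2 t ys)"
    for t ys
  have C: "poly_fun m (\<lambda>t. C)"
    unfolding C_def[abs_def] by (intro poly_fun_minus poly_fun.mult A B 1(1,2)[THEN poly_fun_specialize])
  have H: "poly_fun m H"
    unfolding H_def[abs_def]
    by (intro poly_fun_minus poly_fun.mult poly_fun.add poly_fun_power poly_fun.param poly_fun.const
        A B C 1(1,2)[THEN poly_fun_specialize])
  have expansion: "A t ys / B t ys = A w ys / B w ys + (t - w) * (C ys / B w ys ^ 2) +
      (t - w) ^ 2 * (H t ys / (B t ys * B w ys ^ 2))" if "B t ys \<noteq> 0" "B w ys \<noteq> 0" for t ys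
  proof -
    define x where "x = t - w"
    have "(a0 + x * a1 + x ^ 2 * a2) * b0 ^ 2 =
        a0 * b0 * (b0 + x * b1 + x ^ 2 * b2) + x * (a1 * b0 - a0 * b1) * (b0 + x * b1 + x ^ 2 * b2) +
        x ^ 2 * (a2 * b0 ^ 2 - a0 * b0 * b2 - (a1 * b0 - a0 * b1) * (b1 + x * b2))"
      for a0 a1 a2 b0 b1 b2 :: complex
      by (simp add: algebra_simps power2_eq_square)
    then have "A t ys * B w ys ^ 2 = A w ys * B w ys * B t ys + x * C ys * B t ys + x ^ 2 * H t ys"
      unfolding H_def C_def A(3)[of t ys] B(3)[of t ys] x_def[symmetric] .
    then show ?thesis using that unfolding x_def[symmetric] by (simp add: field_simps power2_eq_square)
  qed
  have key: "ddu u (\<lambda>z. F z xs) z1 = C (map u xs) / B w (map u xs) ^ 2"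
    "ddu u (ddu u (\<lambda>z. F z xs)) z1 = 2 * (H w (map u xs) / (B w (map u xs) * B w (map u xs) ^ 2))"
    if xs: "length xs = m" "P \<notin> set xs" and B0: "B w (map u xs) \<noteq> 0" for xs
  proof -
    obtain p where p: "\<And>t. A t (map u xs) = poly p t" using poly_fun_in_parameter[OF 1(1)] by metis
    obtain q where q: "\<And>t. B t (map u xs) = poly q t" using poly_fun_in_parameter[OF 1(2)] by metis
    obtain r where r: "\<And>t. H t (map u xs) = poly r t" using poly_fun_in_parameter[OF H] by metis
    define \<phi> where "\<phi> t = poly p t / poly q t" for t
    define h where "h t = poly r t / (poly q t * poly q w ^ 2)" for t
    have q0: "poly q w \<noteq> 0" using B0 q by simp
    then have "q \<noteq> 0" by auto
    have an: "\<phi> analytic_on {t}" if "poly q t \<noteq> 0" for t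
      unfolding \<phi>_def using that by (intro analytic_intros poly_analytic_on) auto
    have "h analytic_on {w}"
      unfolding h_def using q0 by (intro analytic_intros poly_analytic_on) auto
    moreover have "eventually (\<lambda>t. \<phi> t = A w (map u xs) / B w (map u xs) +
        (t - w) * (C (map u xs) / B w (map u xs) ^ 2) + (t - w) ^ 2 * h t) (nhds w)"
    proof -
      have "open (- {t. poly q t = 0})"
        using poly_roots_finite[OF \<open>q \<noteq> 0\<close>] finite_imp_closed by blast
      then have "eventually (\<lambda>t. t \<in> - {t. poly q t = 0}) (nhds w)"
        using q0 by (intro eventually_nhds_in_open) auto
      then show ?thesis
      proof eventually_elim
        case (elim t)
        then show ?case
          using expansion[of t "map u xs"] q0 unfolding \<phi>_def h_def p q r by simp
      qed
    qed
    ultimately have d: "deriv \<phi> w = C (map u xs) / B w (map u xs) ^ 2" "deriv (deriv \<phi>) w = 2 * h w"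
      by (rule second_order_expansion)+
    \<comment> \<open>Off the finite set \<open>S\<close> the family is \<open>\<phi>(u)\<close>, hence its derivatives along \<open>d/du\<close> are those
      of \<open>\<phi>\<close>.\<close>
    define S where "S = - N \<union> {z. z \<noteq> P \<and> poly q (u z) = 0}"
    have S: "finite S" using N(1) finite_coordinate_roots[OF u \<open>q \<noteq> 0\<close>] by (simp add: S_def)
    have S': "z \<noteq> P" "poly q (u z) \<noteq> 0" "z \<in> N" if "z \<notin> S" for z
      using that N(3) by (auto simp: S_def)
    have z1: "z1 \<notin> S" using N(2) q0 by (simp add: S_def w_def)
    have F: "F z xs = \<phi> (u z)" if "z \<notin> S" for z
      using 1(5)[OF S'(3)[OF that] xs] S'(2)[OF that] by (simp add: p q \<phi>_def)
    have dF: "ddu u (\<lambda>z. F z xs) z = deriv \<phi> (u z)" if "z \<notin> S" for z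
      by (rule ddu_comp[OF u S'(1)[OF that] S that])
         (use F an[OF S'(2)[OF that]] analytic_on_imp_differentiable_at in auto)
    have "ddu u (ddu u (\<lambda>z. F z xs)) z1 = deriv (deriv \<phi>) (u z1)"
      by (rule ddu_comp[OF u S'(1)[OF z1] S z1])
         (use dF analytic_deriv[OF an[OF S'(2)[OF z1]]] analytic_on_imp_differentiable_at in auto)
    with dF[OF z1] show "ddu u (\<lambda>z. F z xs) z1 = C (map u xs) / B w (map u xs) ^ 2"
      "ddu u (ddu u (\<lambda>z. F z xs)) z1 = 2 * (H w (map u xs) / (B w (map u xs) * B w (map u xs) ^ 2))"
      using d by (simp_all add: w_def[symmetric] h_def q r)
  qed
  show ?thesis
    unfolding has_polydiff_limit_def w_def[symmetric]
  proof (intro exI conjI allI impI)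
    show "poly_fun m (\<lambda>t ys. 2 * H t ys)" by (intro poly_fun.mult poly_fun.const H)
    show "poly_fun m (\<lambda>t ys. B t ys * B w ys ^ 2)"
      by (intro poly_fun.mult poly_fun_power 1(2) 1(2)[THEN poly_fun_specialize])
    show "length ys = m" "B w ys * B w ys ^ 2 \<noteq> 0" using 1 by auto
  next
    fix z2 and xs :: "cp1 list"
    assume z2: "z2 \<in> N - {z1}" and xs: "length xs = m" "P \<notin> set xs"
      and B0: "B (u z2) (map u xs) * B w (map u xs) ^ 2 \<noteq> 0"
    have x: "u z2 - w \<noteq> 0"
      using coordinate_inj_on[OF u] z2 N(2,3) unfolding inj_on_def w_def by auto
    have "F z2 xs = A (u z2) (map u xs) / B (u z2) (map u xs)" "F z1 xs = A w (map u xs) / B w (map u xs)"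
      using 1(5)[of z2 xs] 1(5)[of z1 xs] z2 xs B0 N(2) by (auto simp: w_def)
    then have "F z2 xs - F z1 xs - (u z2 - w) * ddu u (\<lambda>z. F z xs) z1 =
      (u z2 - w) ^ 2 * (H (u z2) (map u xs) / (B (u z2) (map u xs) * B w (map u xs) ^ 2))"
      using expansion[of "u z2" "map u xs"] B0 key(1)[OF xs] by simp
    then show "2 / (u z2 - w) ^ 2 * (F z2 xs - F z1 xs - (u z2 - w) * ddu u (\<lambda>z. F z xs) z1) =
      2 * H (u z2) (map u xs) / (B (u z2) (map u xs) * B w (map u xs) ^ 2)"
      using x by simp
  next
    fix xs :: "cp1 list"
    assume "length xs = m" "P \<notin> set xs" "B w (map u xs) * B w (map u xs) ^ 2 \<noteq> 0"
    then show "ddu u (ddu u (\<lambda>z. F z xs)) z1 =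
        2 * H w (map u xs) / (B w (map u xs) * B w (map u xs) ^ 2)"
      using key(2)[of xs] by simp
  qed
qed

section \<open>The operator product of T and b\<close>

text \<open>The part of \<open>2 T(z) b(z1) v\<close> that stays regular as \<open>z\<close> tends to \<open>z1\<close>: all multiplications are
  moved to the left of all contractions, and the terms from the commutator of \<open>i(z)\<close> with \<open>e(z1)\<close>
  are dropped.\<close>

definition normal_ordered_part :: "(cp1 \<Rightarrow> complex) \<Rightarrow> cp1 \<Rightarrow> symK \<Rightarrow> cp1 \<Rightarrow> symK" where
  "normal_ordered_part u z1 v z =
     i_hat u z (i_hat u z (i_hat u z1 v)) + e_hat u z1 (i_hat u z (i_hat u z v)) +
     2 * e_hat u z (i_hat u z (i_hat u z1 v)) + e_hat u z (e_hat u z (i_hat u z1 v)) +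
     2 * e_hat u z (e_hat u z1 (i_hat u z v)) + e_hat u z (e_hat u z (e_hat u z1 v))"

lemma normal_ordered_part_diagonal: "normal_ordered_part u z v z = S_hat u z v"
  unfolding normal_ordered_part_def S_hat_def e_hat_def by (simp add: algebra_simps)

text \<open>The commutator of \<open>i(z2)\<close> with \<open>e(z1)\<close> is the scalar \<open>- e_form u z1\<close> at \<open>z2\<close>, which is
  \<open>1 / (u z2 - u z1)\<^sup>2\<close>. With this scalar as \<open>c\<close>, the term \<open>i(z2) i(z2) e(z1)\<close> contributes
  \<open>2 c i(z2)\<close> and \<open>2 e(z2) i(z2) e(z1)\<close> contributes \<open>2 c e(z2)\<close>, together \<open>2 c b(z2)\<close>.\<close>

lemma polydiff_T_hat_b_hat:
  assumes u: "is_coordinate u P" and z: "z1 \<noteq> P" "z2 \<noteq> P" "z2 \<noteq> z1"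
    and v: "v \<in> Wreg z2" "i_hat u z1 v \<in> Wreg z2"
  shows "b_hat u z1 v \<in> Wreg z2"
    "2 * polydiff u (T_hat u z2 (b_hat u z1 v)) xs =
     2 / (u z2 - u z1) ^ 2 * polydiff u (b_hat u z2 v) xs + polydiff u (normal_ordered_part u z1 v z2) xs"
proof -
  define c where "c = of_scalar (1 / (u z2 - u z1) ^ 2)"
  define E1 where "E1 = of_form (e_form u z1)"
  define X where "X = i_hat u z1 v"
  have "u z2 \<noteq> u z1" using coordinate_inj_on[OF u] z unfolding inj_on_def by auto
  then have e: "regular_at z2 (e_form u z1)" "form_val u z2 (e_form u z1) = - (1 / (u z2 - u z1) ^ 2)"
    using rational_form_e_form[OF u, of z1] z(2) by (auto simp: rational_form_def)
  have E1: "E1 \<in> Wreg z2" "i_hat u z2 E1 = c"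
    using i_hat_of_form[OF e(1), of u] e Wreg.form by (auto simp: E1_def c_def)
  have cW: "c * w \<in> Wreg z2" if "w \<in> Wreg z2" for w
    unfolding c_def using that by (intro Wreg.intros)
  have X: "X \<in> Wreg z2" using v(2) by (simp add: X_def)
  show b: "b_hat u z1 v \<in> Wreg z2"
    using X E1 v(1) by (auto simp: b_hat_def e_hat_def X_def E1_def intro: Wreg.intros)
  have I: "i_hat u z2 (E1 * w) = c * w + E1 * i_hat u z2 w" if "w \<in> Wreg z2" for w
    using i_hat_simps(3)[OF E1(1) that, of u] E1(2) by simp
  have Ic: "i_hat u z2 (c * w) = c * i_hat u z2 w" if "w \<in> Wreg z2" for w
    unfolding c_def by (rule i_hat_simps(4)[OF that that])
  note W = i_hat_simps(1)[OF v(1) v(1), of u] i_hat_simps(1)[OF X X, of u]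
  have I1: "i_hat u z2 (X + E1 * v) = i_hat u z2 X + (c * v + E1 * i_hat u z2 v)"
    using i_hat_simps(2)[OF X Wreg.mult[OF E1(1) v(1)], of u] I[OF v(1)] by simp
  have "i_hat u z2 (i_hat u z2 X + (c * v + E1 * i_hat u z2 v)) =
      i_hat u z2 (i_hat u z2 X) + (c * i_hat u z2 v + (c * i_hat u z2 v + E1 * i_hat u z2 (i_hat u z2 v)))"
    using i_hat_simps(2)[OF W(2) Wreg.add[OF cW[OF v(1)] Wreg.mult[OF E1(1) W(1)]], of u]
      i_hat_simps(2)[OF cW[OF v(1)] Wreg.mult[OF E1(1) W(1)], of u] I[OF W(1)] Ic[OF v(1)] by simp
  then have "i_hat u z2 (i_hat u z2 (X + E1 * v)) + e_hat u z2 (e_hat u z2 (X + E1 * v)) +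
      2 * e_hat u z2 (i_hat u z2 (X + E1 * v)) =
    (c + c) * b_hat u z2 v + normal_ordered_part u z1 v z2"
    unfolding I1 normal_ordered_part_def b_hat_def e_hat_def X_def[symmetric] E1_def[symmetric]
    by (simp add: algebra_simps)
  moreover have "b_hat u z1 v = X + E1 * v" by (simp add: b_hat_def e_hat_def X_def E1_def)
  moreover have "c + c = of_scalar (2 / (u z2 - u z1) ^ 2)"
    unfolding c_def of_scalar_add[symmetric] by simp
  ultimately show "2 * polydiff u (T_hat u z2 (b_hat u z1 v)) xs =
     2 / (u z2 - u z1) ^ 2 * polydiff u (b_hat u z2 v) xs + polydiff u (normal_ordered_part u z1 v z2) xs"
    by (simp add: T_hat_def polydiff_scale polydiff_add)
qed

lemma rational_families:
  assumes u: "is_coordinate u P" and N: "z1 \<in> N" "P \<notin> N" and v: "(\<lambda>z. v) \<in> regular_family u P N"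
  shows "(\<lambda>z. b_hat u z v) \<in> rational_family u P N z1"
    "normal_ordered_part u z1 v \<in> rational_family u P N z1"
    "(\<lambda>z. i_hat u z1 v) \<in> regular_family u P N"
proof -
  have i: "(\<lambda>z. i_hat u z (V z)) \<in> regular_family u P N" if "V \<in> regular_family u P N" for V
    using that N(2) by (rule regular_family_i_hat)
  have const: "(\<lambda>z. V z1) \<in> regular_family u P N" if "V \<in> regular_family u P N" for V
    using that N(1) by (rule regular_family_const)
  show v1: "(\<lambda>z. i_hat u z1 v) \<in> regular_family u P N" by (rule const[OF i[OF v]])
  have e: "(\<lambda>z. of_form (e_form u z)) \<in> rational_family u P N z1"
    by (rule rational_family_of_form[OF form_family_e_form[OF u]])
  have e1: "(\<lambda>z. of_form (e_form u z1)) \<in> rational_family u P N z1"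
    by (rule rational_family_of_form[OF form_family_const[OF rational_form_e_form[OF u]]]) simp
  have "of_scalar 2 = (2 :: symK)" using of_scalar_add[of 1 1] by (simp add: of_scalar_1)
  then have two: "(\<lambda>z. 2) \<in> rational_family u P N z1"
    using regular_family_rational[OF regular_family.scalar[OF rational_on_const[of u N 2]] N(1), of P] by simp
  note reg = regular_family_rational[OF _ N(1)]
  show "(\<lambda>z. b_hat u z v) \<in> rational_family u P N z1"
    unfolding b_hat_def e_hat_def by (intro rational_family.add rational_family_mult e reg i v)
  show "normal_ordered_part u z1 v \<in> rational_family u P N z1"
    unfolding normal_ordered_part_def[abs_def] e_hat_def
    by (intro rational_family.add rational_family_mult e e1 two reg[OF i[OF i[OF v1]]] reg[OF i[OF i[OF v]]]
        reg[OF i[OF v1]] reg[OF v1] reg[OF i[OF v]] reg[OF v])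
qed

theorem proposition4p3:
  fixes u :: "cp1 \<Rightarrow> complex" and P z1 :: cp1 and v :: symK
  assumes "is_coordinate u P"
    and "z1 \<noteq> P"
    and "v \<in> Wreg z1"
  shows "\<exists>N. finite (- N) \<and> z1 \<in> N \<and> P \<notin> N \<and>
    (\<forall>z2\<in>N. v \<in> Wreg z2) \<and>
    (\<forall>z2\<in>N - {z1}. b_hat u z1 v \<in> Wreg z2) \<and>
    (\<forall>m. has_polydiff_limit u P N m z1
      (\<lambda>z2 xs.
         2 * polydiff u (T_hat u z2 (b_hat u z1 v)) xs
         - 2 / (u z2 - u z1) ^ 2 * polydiff u (b_hat u z1 v) xs
         - 2 / (u z2 - u z1) * b_hat_deriv u 1 z1 v xs)
      (\<lambda>xs. polydiff u (S_hat u z1 v) xs + b_hat_deriv u 2 z1 v xs))"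
proof -
  obtain N where N: "finite (- N)" "z1 \<in> N" "P \<notin> N" and v: "(\<lambda>z. v) \<in> regular_family u P N"
    using Wreg_regular_family[OF assms] by blast
  note fam = rational_families[OF assms(1) N(2,3) v]
  have vW: "v \<in> Wreg z2" and X: "i_hat u z1 v \<in> Wreg z2" if "z2 \<in> N" for z2
    using regular_family_Wreg[OF v N(3,2) that] regular_family_Wreg[OF fam(3) N(3,2) that] by auto
  have z2P: "z2 \<noteq> P" if "z2 \<in> N" for z2 using that N(3) by auto
  have b: "b_hat u z1 v \<in> Wreg z2" if "z2 \<in> N - {z1}" for z2
    using polydiff_T_hat_b_hat(1)[OF assms(1,2) z2P _ vW X] that by blast
  have "has_polydiff_limit u P N m z1
      (\<lambda>z2 xs.
         2 * polydiff u (T_hat u z2 (b_hat u z1 v)) xs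
         - 2 / (u z2 - u z1) ^ 2 * polydiff u (b_hat u z1 v) xs
         - 2 / (u z2 - u z1) * b_hat_deriv u 1 z1 v xs)
      (\<lambda>xs. polydiff u (S_hat u z1 v) xs + b_hat_deriv u 2 z1 v xs)" for m
  proof (rule has_polydiff_limit_cong)
    show "has_polydiff_limit u P N m z1
      (\<lambda>z xs. polydiff u (normal_ordered_part u z1 v z) xs +
         2 / (u z - u z1) ^ 2 * (polydiff u (b_hat u z v) xs - polydiff u (b_hat u z1 v) xs -
           (u z - u z1) * ddu u (\<lambda>z. polydiff u (b_hat u z v) xs) z1))
      (\<lambda>xs. polydiff u (normal_ordered_part u z1 v z1) xs +
         ddu u (ddu u (\<lambda>z. polydiff u (b_hat u z v) xs)) z1)"
      by (rule has_polydiff_limit_add[OF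
            has_polydiff_limit_ratfun[OF ratfun_polydiff[OF fam(2) N(2)] N(2)]
            has_polydiff_limit_taylor[OF assms(1) N ratfun_polydiff[OF fam(1) N(2)]]])
  next
    fix z2 and xs :: "cp1 list" assume z2: "z2 \<in> N - {z1}"
    then have "u z2 - u z1 \<noteq> 0"
      using coordinate_inj_on[OF assms(1)] N(2,3) unfolding inj_on_def by auto
    moreover have "2 / d ^ 2 * d = 2 / d" if "d \<noteq> 0" for d :: complex
      using that by (simp add: power2_eq_square)
    ultimately have "2 / (u z2 - u z1) ^ 2 * (u z2 - u z1) = 2 / (u z2 - u z1)"
      by blast
    then show "2 * polydiff u (T_hat u z2 (b_hat u z1 v)) xs
         - 2 / (u z2 - u z1) ^ 2 * polydiff u (b_hat u z1 v) xs
         - 2 / (u z2 - u z1) * b_hat_deriv u 1 z1 v xs =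
       polydiff u (normal_ordered_part u z1 v z2) xs +
         2 / (u z2 - u z1) ^ 2 * (polydiff u (b_hat u z2 v) xs - polydiff u (b_hat u z1 v) xs -
           (u z2 - u z1) * ddu u (\<lambda>z. polydiff u (b_hat u z v) xs) z1)"
      using polydiff_T_hat_b_hat(2)[OF assms(1,2) z2P _ vW X, of z2 xs] z2
      by (simp add: b_hat_deriv_def right_diff_distrib mult.assoc[symmetric])
  qed (simp add: normal_ordered_part_diagonal b_hat_deriv_def numeral_2_eq_2)
  then show ?thesis using N vW b by blast
qed

end
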